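(* (1) For any two $\mathbb{Z}^d$-odometers that are continuously orbit equivalent, there is a cone $\mathsf{C}\subseteq\mathbb{Z}^d$ such that one of the odometers is conjugate to a $\mathsf{C}$-speedup of the other. (2) There exist two $\mathbb{Z}^2$-odometers that are continuously orbit equivalent and a cone $\mathsf{C}\subseteq\mathbb{Z}^2$ such that no bounded $\mathsf{C}$-speedup of one odometer is conjugate to the other.
   Context: A $\mathbb{Z}^d$-action $\mathbf{T}:\mathbb{Z}^d\curvearrowright X$ on a topological space $X$ assigns to each $\mathbf{v}\in\mathbb{Z}^d$ a homeomorphism $\mathbf{T}^{\mathbf{v}}:X\to X$ with $\mathbf{T}^{\mathbf{v}+\mathbf{w}}=\mathbf{T}^{\mathbf{v}}\circ\mathbf{T}^{\mathbf{w}}$ and $\mathbf{T}^{\mathbf{0}}=\mathrm{id}$. It is free if $\mathbf{T}^{\mathbf{v}}(x)=x$ for some $x$ implies $\mathbf{v}=\mathbf{0}$. Actions $\mathbf{T}:\mathbb{Z}^d\curvearrowright X$ and $\mathbf{S}:\mathbb{Z}^d\curvearrowright Y$ are conjugate if there is a homeomorphism $\Phi:X\to Y$ with $\Phi\circ\mathbf{T}^{\mathbf{v}}=\mathbf{S}^{\mathbf{v}}\circ\Phi$ for all $\mathbf{v}$. Actions $\mathbf{T}:\mathbb{Z}^{d_1}\curvearrowright X$ and $\mathbf{S}:\mathbb{Z}^{d_2}\curvearrowright Y$ are orbit equivalent via a homeomorphism $\Phi:X\to Y$ if $\Phi(\{\mathbf{T}^{\mathbf{v}}(x):\mathbf{v}\in\mathbb{Z}^{d_1}\})=\{\mathbf{S}^{\mathbf{v}}(\Phi(x)):\mathbf{v}\in\mathbb{Z}^{d_2}\}$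 for every $x\in X$. For free actions, such a $\Phi$ determines orbit cocycles $\mathbf{h}_\Phi:X\times\mathbb{Z}^{d_2}\to\mathbb{Z}^{d_1}$ and $\mathbf{h}_{\Phi^{-1}}:Y\times\mathbb{Z}^{d_1}\to\mathbb{Z}^{d_2}$ by $\mathbf{S}^{\mathbf{v}}(\Phi(x))=\Phi(\mathbf{T}^{\mathbf{h}_\Phi(x,\mathbf{v})}(x))$ and $\mathbf{T}^{\mathbf{w}}(\Phi^{-1}(y))=\Phi^{-1}(\mathbf{S}^{\mathbf{h}_{\Phi^{-1}}(y,\mathbf{w})}(y))$. Two (free) actions are continuously orbit equivalent if there is an orbit equivalence $\Phi$ whose orbit cocycles are both continuous (for the given topologies on $X,Y$, discrete topologies on $\mathbb{Z}^{d_i}$, and product topologies). A filled cone is an open, connected subset of $\mathbb{R}^d$ whose boundary consists of (portions of) $d$ distinct hyperplanes passing through the origin; a cone is the intersection of a filled cone with $\mathbb{Z}^d-\{\mathbf{0}\}$. Cones are understood to be closed under addition. A cocycle for $\mathbf{T}:\mathbb{Z}^{d_1}\curvearrowright X$ is a function $\mathbf{p}:X\times\mathbb{Z}^{d_2}\to\mathbb{Z}^{d_1}$ with $\mathbf{p}(x,\mathbf{0})=\mathbf{0}$ and $\mathbf{p}(x,\mathbf{v})+\mathbf{p}(\mathbf{T}^{\mathbf{p}(x,\mathbf{v})}(x),\mathbf{w})=\mathbf{p}(x,\mathbf{v}+\mathbf{w})$ for all $x\in X$ and $\mathbf{v},\mathbf{w}\in\mathbb{Z}^{d_2}$. A speedup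 of $(X,\mathbf{T})$ is an action (by homeomorphisms) $\mathbf{S}:\mathbb{Z}^{d_2}\curvearrowright X$ with $\mathbf{S}^{\mathbf{v}}(x)=\mathbf{T}^{\mathbf{p}(x,\mathbf{v})}(x)$ for some cocycle $\mathbf{p}$ for $\mathbf{T}$ (the speedup cocycle). Given a cone $\mathsf{C}\subseteq\mathbb{Z}^{d_1}$, it is a $\mathsf{C}$-speedup if moreover $\mathbf{p}(x,\mathbf{e}_j)\in\mathsf{C}$ for all $x\in X$ and all standard basis vectors $\mathbf{e}_j$ of $\mathbb{Z}^{d_2}$. The speedup is bounded if for each $\mathbf{v}\in\mathbb{Z}^{d_2}$ the set $\{\mathbf{p}(x,\mathbf{v}):x\in X\}$ is bounded. Let $\mathfrak{G}=\{G_j\}_{j\ge1}$ be a decreasing sequence of finite-index subgroups of $\mathbb{Z}^d$, and let $X_{\mathfrak{G}}=\varprojlim\mathbb{Z}^d/G_j$ be the inverse limit along the quotient maps $\mathbb{Z}^d/G_{j+1}\to\mathbb{Z}^d/G_j$ (topologized as a subspace of the product of discrete spaces), with the action $\sigma_{\mathfrak{G}}^{\mathbf{v}}(\mathbf{x}_1,\mathbf{x}_2,\dots)=(\mathbf{x}_1+\mathbf{v},\mathbf{x}_2+\mathbf{v},\dots)$, the $j$-th coordinate taken mod $G_j$. A $\mathbb{Z}^d$-odometer is any $\mathbb{Z}^d$-action conjugate to some such $(X_{\mathfrak{G}},\sigma_{\mathfrak{G}})$. *)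

theory Defs
  imports "HOL-Analysis.Analysis" "HOL-Algebra.Coset"
begin

section \<open>Actions of integer lattices on topological spaces\<close>

definition zd_action :: "'a topology \<Rightarrow> (int^'d \<Rightarrow> 'a \<Rightarrow> 'a) \<Rightarrow> bool" where
  "zd_action X T \<longleftrightarrow>
     (\<forall>v. homeomorphic_map X X (T v)) \<and>
     (\<forall>v w. \<forall>x\<in>topspace X. T (v + w) x = T v (T w x)) \<and>
     (\<forall>x\<in>topspace X. T 0 x = x)"

definition free_action :: "'a topology \<Rightarrow> (int^'d \<Rightarrow> 'a \<Rightarrow> 'a) \<Rightarrow> bool" where
  "free_action X T \<longleftrightarrow> zd_action X T \<and> (\<forall>v. \<forall>x\<in>topspace X. T v x = x \<longrightarrow> v = 0)"

definition conjugate ::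
  "'a topology \<Rightarrow> (int^'d \<Rightarrow> 'a \<Rightarrow> 'a) \<Rightarrow> 'b topology \<Rightarrow> (int^'d \<Rightarrow> 'b \<Rightarrow> 'b) \<Rightarrow> bool" where
  "conjugate X T Y S \<longleftrightarrow>
     (\<exists>\<Phi>. homeomorphic_map X Y \<Phi> \<and> (\<forall>v. \<forall>x\<in>topspace X. \<Phi> (T v x) = S v (\<Phi> x)))"

section \<open>Continuous orbit equivalence\<close>

definition orbit_equivalent_via ::
  "'a topology \<Rightarrow> (int^'m \<Rightarrow> 'a \<Rightarrow> 'a) \<Rightarrow> 'b topology \<Rightarrow> (int^'n \<Rightarrow> 'b \<Rightarrow> 'b) \<Rightarrow> ('a \<Rightarrow> 'b) \<Rightarrow> bool" where
  "orbit_equivalent_via X T Y S \<Phi> \<longleftrightarrow>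
     homeomorphic_map X Y \<Phi> \<and>
     (\<forall>x\<in>topspace X. \<Phi> ` range (\<lambda>v. T v x) = range (\<lambda>v. S v (\<Phi> x)))"

text \<open>If the action \<open>T\<close> is free and \<open>\<Phi>\<close> is an orbit equivalence, then exactly one function
  \<open>h\<close> (on \<open>topspace X\<close>) satisfies this predicate.\<close>

definition orbit_cocycle ::
  "'a topology \<Rightarrow> (int^'m \<Rightarrow> 'a \<Rightarrow> 'a) \<Rightarrow> (int^'n \<Rightarrow> 'b \<Rightarrow> 'b) \<Rightarrow> ('a \<Rightarrow> 'b)
     \<Rightarrow> ('a \<times> (int^'n) \<Rightarrow> int^'m) \<Rightarrow> bool" where
  "orbit_cocycle X T S \<Phi> h \<longleftrightarrow> (\<forall>x\<in>topspace X. \<forall>v. S v (\<Phi> x) = \<Phi> (T (h (x, v)) x))"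

definition continuous_cocycle :: "'a topology \<Rightarrow> ('a \<times> (int^'n) \<Rightarrow> int^'m) \<Rightarrow> bool" where
  "continuous_cocycle X h \<longleftrightarrow>
     continuous_map (prod_topology X (discrete_topology UNIV)) (discrete_topology UNIV) h"

text \<open>Orbit cocycles are only determined for free actions, so freeness of both actions is part
  of the notion. \<open>\<Psi>\<close> is the inverse homeomorphism of \<open>\<Phi>\<close>.\<close>

definition continuously_orbit_equivalent ::
  "'a topology \<Rightarrow> (int^'m \<Rightarrow> 'a \<Rightarrow> 'a) \<Rightarrow> 'b topology \<Rightarrow> (int^'n \<Rightarrow> 'b \<Rightarrow> 'b) \<Rightarrow> bool" where
  "continuously_orbit_equivalent X T Y S \<longleftrightarrow>
     free_action X T \<and> free_action Y S \<and>
     (\<exists>\<Phi> \<Psi> h k. orbit_equivalent_via X T Y S \<Phi> \<and> homeomorphic_maps X Y \<Phi> \<Psi> \<and>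
        orbit_cocycle X T S \<Phi> h \<and> continuous_cocycle X h \<and>
        orbit_cocycle Y S T \<Psi> k \<and> continuous_cocycle Y k)"

section \<open>Cones\<close>

text \<open>The boundary lies in the union of the hyperplanes, and every one of the \<open>d\<close> hyperplanes
  really contributes: the part of it lying in the boundary has nonempty interior relative to the
  hyperplane.\<close>

definition filled_cone :: "(real^'d) set \<Rightarrow> bool" where
  "filled_cone F \<longleftrightarrow> open F \<and> connected F \<and>
     (\<exists>\<H>. card \<H> = CARD('d) \<and>
        (\<forall>H\<in>\<H>. \<exists>a. a \<noteq> 0 \<and> H = {x. a \<bullet> x = 0}) \<and>
        frontier F \<subseteq> \<Union>\<H> \<and>
        (\<forall>H\<in>\<H>. (top_of_set H) interior_of (frontier F \<inter> H) \<noteq> {}))"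

definition real_vec :: "int^'d \<Rightarrow> real^'d" where
  "real_vec v = (\<chi> i. real_of_int (v $ i))"

text \<open>Closure under addition is imposed on the filled cone. It passes to the set of lattice
  points (lemma \<open>lattice_cone_add\<close>). Imposed on the lattice points alone, it would still admit
  degenerate regions such as an open half plane with a slit removed.\<close>

definition lattice_cone :: "(int^'d) set \<Rightarrow> bool" where
  "lattice_cone C \<longleftrightarrow>
     (\<exists>F. filled_cone F \<and> (\<forall>x\<in>F. \<forall>y\<in>F. x + y \<in> F) \<and> C = {v. real_vec v \<in> F} - {0})"

lemma filled_cone_zero_notin:
  fixes F :: "(real^'d) set"
  assumes F: "filled_cone F" and add: "\<forall>x\<in>F. \<forall>y\<in>F. x + y \<in> F"
  shows "0 \<notin> F"
proof
  assume z: "0 \<in> F"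
  have "open F" using F by (simp add: filled_cone_def)
  then obtain e where e: "e > 0" "ball 0 e \<subseteq> F"
    using z open_contains_ball by blast
  have mult: "real n *\<^sub>R x \<in> F" if "x \<in> F" for n x
    by (induction n) (use z add that in \<open>auto simp: algebra_simps\<close>)
  have "x \<in> F" for x
  proof -
    obtain n :: nat where n: "real n > norm x / e" using reals_Archimedean2 by blast
    then have pos: "real n > 0"
      using e(1) by (meson divide_nonneg_pos le_less_trans norm_ge_zero)
    have "norm x < e * real n" using n e(1) by (simp add: field_simps)
    then have "(1 / real n) *\<^sub>R x \<in> ball 0 e"
      using pos by (simp add: field_simps)
    then have "real n *\<^sub>R ((1 / real n) *\<^sub>R x) \<in> F" using e(2) mult by blast
    then show ?thesis using pos by simp
  qed
  then have "frontier F = {}" by (metis UNIV_eq_I frontier_UNIV)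
  moreover obtain \<H> where \<H>: "card \<H> = CARD('d)"
    "\<forall>H\<in>\<H>. (top_of_set H) interior_of (frontier F \<inter> H) \<noteq> {}"
    using F unfolding filled_cone_def by blast
  moreover have "\<H> \<noteq> {}" using \<H>(1) by auto
  ultimately show False by auto
qed

lemma lattice_cone_add:
  assumes "lattice_cone C" "u \<in> C" "v \<in> C"
  shows "u + v \<in> C"
proof -
  obtain F where F: "filled_cone F" "\<forall>x\<in>F. \<forall>y\<in>F. x + y \<in> F" "C = {v. real_vec v \<in> F} - {0}"
    using assms(1) unfolding lattice_cone_def by blast
  have "real_vec (u + v) = real_vec u + real_vec v" by (simp add: real_vec_def vec_eq_iff)
  then have "real_vec (u + v) \<in> F" using F assms by auto
  moreover have "real_vec (0 :: int^'a) = 0" by (simp add: real_vec_def vec_eq_iff)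
  then have "u + v \<noteq> 0" using calculation filled_cone_zero_notin[OF F(1,2)] by auto
  ultimately show ?thesis using F by auto
qed

section \<open>Speedups\<close>

definition cocycle ::
  "'a topology \<Rightarrow> (int^'m \<Rightarrow> 'a \<Rightarrow> 'a) \<Rightarrow> ('a \<times> (int^'n) \<Rightarrow> int^'m) \<Rightarrow> bool" where
  "cocycle X T p \<longleftrightarrow>
     (\<forall>x\<in>topspace X. p (x, 0) = 0) \<and>
     (\<forall>x\<in>topspace X. \<forall>v w. p (x, v) + p (T (p (x, v)) x, w) = p (x, v + w))"

definition speedup_via ::
  "'a topology \<Rightarrow> (int^'m \<Rightarrow> 'a \<Rightarrow> 'a) \<Rightarrow> ('a \<times> (int^'n) \<Rightarrow> int^'m) \<Rightarrow> (int^'n \<Rightarrow> 'a \<Rightarrow> 'a) \<Rightarrow> bool"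
where
  "speedup_via X T p S \<longleftrightarrow>
     cocycle X T p \<and> zd_action X S \<and> (\<forall>v. \<forall>x\<in>topspace X. S v x = T (p (x, v)) x)"

definition cone_valued ::
  "'a topology \<Rightarrow> (int^'m) set \<Rightarrow> ('a \<times> (int^'n) \<Rightarrow> int^'m) \<Rightarrow> bool" where
  "cone_valued X C p \<longleftrightarrow> (\<forall>x\<in>topspace X. \<forall>j. p (x, axis j 1) \<in> C)"

definition bounded_cocycle :: "'a topology \<Rightarrow> ('a \<times> (int^'n) \<Rightarrow> int^'m) \<Rightarrow> bool" where
  "bounded_cocycle X p \<longleftrightarrow> (\<forall>v. bounded ((\<lambda>x. real_vec (p (x, v))) ` topspace X))"

definition cone_speedup ::
  "'a topology \<Rightarrow> (int^'m \<Rightarrow> 'a \<Rightarrow> 'a) \<Rightarrow> (int^'m) set \<Rightarrow> (int^'n \<Rightarrow> 'a \<Rightarrow> 'a) \<Rightarrow> bool" where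
  "cone_speedup X T C S \<longleftrightarrow> (\<exists>p. speedup_via X T p S \<and> cone_valued X C p)"

definition bounded_cone_speedup ::
  "'a topology \<Rightarrow> (int^'m \<Rightarrow> 'a \<Rightarrow> 'a) \<Rightarrow> (int^'m) set \<Rightarrow> (int^'n \<Rightarrow> 'a \<Rightarrow> 'a) \<Rightarrow> bool" where
  "bounded_cone_speedup X T C S \<longleftrightarrow>
     (\<exists>p. speedup_via X T p S \<and> cone_valued X C p \<and> bounded_cocycle X p)"

section \<open>Odometers\<close>

definition Zd :: "(int^'d) monoid" where
  "Zd = \<lparr>carrier = UNIV, monoid.mult = (+), one = 0\<rparr>"

definition odometer_groups :: "(nat \<Rightarrow> (int^'d) set) \<Rightarrow> bool" where
  "odometer_groups G \<longleftrightarrow>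
     (\<forall>j. subgroup (G j) Zd \<and> finite (rcosets\<^bsub>Zd\<^esub> (G j))) \<and> decseq G"

text \<open>Points of the inverse limit are sequences of cosets. The quotient map from
  cosets of \<open>G (Suc j)\<close> to cosets of \<open>G j\<close> sends \<open>K\<close> to \<open>G j + K\<close>.\<close>

definition odometer_set :: "(nat \<Rightarrow> (int^'d) set) \<Rightarrow> (nat \<Rightarrow> (int^'d) set) set" where
  "odometer_set G =
     {x. \<forall>j. x j \<in> rcosets\<^bsub>Zd\<^esub> (G j) \<and> x j = G j <#>\<^bsub>Zd\<^esub> x (Suc j)}"

definition odometer_space :: "(nat \<Rightarrow> (int^'d) set) \<Rightarrow> (nat \<Rightarrow> (int^'d) set) topology" where
  "odometer_space G =
     subtopology (product_topology (\<lambda>j. discrete_topology (rcosets\<^bsub>Zd\<^esub> (G j))) UNIV)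
       (odometer_set G)"

definition odometer_map :: "int^'d \<Rightarrow> (nat \<Rightarrow> (int^'d) set) \<Rightarrow> (nat \<Rightarrow> (int^'d) set)" where
  "odometer_map v x = (\<lambda>j. x j #>\<^bsub>Zd\<^esub> v)"

definition odometer :: "'a topology \<Rightarrow> (int^'d \<Rightarrow> 'a \<Rightarrow> 'a) \<Rightarrow> bool" where
  "odometer X T \<longleftrightarrow> zd_action X T \<and>
     (\<exists>G. odometer_groups G \<and> conjugate X T (odometer_space G) odometer_map)"

end

theory Submission
  imports Defs
begin

text \<open>
  Both parts rest on one rigidity fact, \<open>cocycle_over_odometer\<close>. Let \<open>S\<close> be an odometer and
  \<open>p\<close> a continuous cocycle over \<open>S\<close> with values in a lattice. By compactness
  \<open>p (x, e\<^sub>i)\<close> depends only on the coset \<open>\<tau> x\<close> of \<open>x\<close> modulo some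
  finite-index subgroup \<open>G\<close> of the defining sequence. Hence
  \<open>p (x, v) = q (\<tau> x + v) - q (\<tau> x)\<close> for a function \<open>q\<close> of the lattice that
  satisfies \<open>q (v + g) = q v + A g\<close> for \<open>g \<in> G\<close>, where \<open>A\<close> is a homomorphism.

  For the first part, the orbit equivalence turns \<open>S\<close> into an action on \<open>X\<close> with the same orbits
  as \<open>T\<close>, and \<open>S v x = T (p (x, v)) x\<close> for a cocycle as above whose \<open>q\<close> is a bijection
  of the lattice. Conjugating \<open>S\<close> by a homeomorphism that moves each coset of \<open>G\<close> along its
  orbits by a fixed vector replaces \<open>q\<close> by \<open>q \<circ> \<pi>\<close>, where the permutation \<open>\<pi>\<close> of
  the lattice commutes with translations by \<open>G\<close>. It suffices that the increments of
  \<open>q \<circ> \<pi>\<close> along basis vectors lie in an open half space: there are finitely many of them, so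
  a wide cone then contains them all (\<open>lattice_cone_in_half_space\<close>). In dimension at least two such a
  \<open>\<pi>\<close> is found by shifting cosets until the pull-back of a suitable linear functional under
  \<open>q\<close> is close to the functional itself (\<open>monotone_rearrangement\<close>). In dimension one a
  counting argument shows that \<open>A\<close> is plus or minus the identity, and \<open>q\<close> can be rearranged into
  plus or minus the identity (\<open>monotone_rearrangement_dim_one\<close>). The resulting speedup is even bounded:
  its price is that the cone depends on the orbit equivalence.

  For the second part the cone is prescribed instead. Take both odometers equal to the inverse limit of
  \<open>\<int>\<^sup>2 / (2\<^sup>k \<int> \<times> 3\<^sup>k \<int>)\<close>, and let the cone be the open first
  quadrant. A bounded speedup has a continuous cocycle, so it has a translation part \<open>A\<close>. If the speedup
  is conjugate to the odometer, then \<open>A\<close> is compatible with the defining groups, and comparing powers of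
  \<open>2\<close> and \<open>3\<close> shows that \<open>A\<close> maps the first axis to itself. But a speedup in the quadrant
  moves positive multiples of \<open>e\<^sub>1\<close> into the open quadrant, away from that axis.
\<close>

section \<open>Finite-index subgroups of the integer lattice\<close>

lemma Zd_simps [simp]:
  "carrier Zd = UNIV" "x \<otimes>\<^bsub>Zd\<^esub> y = x + y" "\<one>\<^bsub>Zd\<^esub> = 0"
  by (simp_all add: Zd_def)

lemma group_Zd: "group (Zd :: (int^'d) monoid)"
proof (rule groupI)
  fix x :: "int^'d"
  show "\<exists>y\<in>carrier Zd. y \<otimes>\<^bsub>Zd\<^esub> x = \<one>\<^bsub>Zd\<^esub>" by (rule bexI[of _ "- x"]) auto
qed (auto simp: algebra_simps)

lemma Zd_inv [simp]: "inv\<^bsub>Zd\<^esub> x = - (x :: int^'d)"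
  by (rule group.inv_equality[OF group_Zd]) auto

lemma Zd_subgroup_closed:
  assumes "subgroup G (Zd :: (int^'d) monoid)"
  shows Zd_subgroup_zero: "0 \<in> G"
    and Zd_subgroup_add: "u \<in> G \<Longrightarrow> v \<in> G \<Longrightarrow> u + v \<in> G"
    and Zd_subgroup_minus: "u \<in> G \<Longrightarrow> - u \<in> G"
    and Zd_subgroup_diff: "u \<in> G \<Longrightarrow> v \<in> G \<Longrightarrow> u - v \<in> G"
proof -
  show zero: "0 \<in> G" using subgroup.one_closed[OF assms] by simp
  show add: "u \<in> G \<Longrightarrow> v \<in> G \<Longrightarrow> u + v \<in> G" for u v
    using subgroup.m_closed[OF assms, of u v] by simp
  show min: "u \<in> G \<Longrightarrow> - u \<in> G" for u
    using subgroup.m_inv_closed[OF assms, of u] by simp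
  show "u \<in> G \<Longrightarrow> v \<in> G \<Longrightarrow> u - v \<in> G" for u v
    using add[of u "- v"] min by simp
qed

lemma Zd_subgroup_scale:
  assumes G: "subgroup G (Zd :: (int^'d) monoid)" and u: "u \<in> G"
  shows "k *s u \<in> G"
proof (induction k rule: int_induct[where k = 0])
  case base
  show ?case using Zd_subgroup_zero[OF G] by simp
next
  case (step1 i)
  then show ?case using Zd_subgroup_add[OF G _ u] by (simp add: vector_sadd_rdistrib)
next
  case (step2 i)
  then show ?case using Zd_subgroup_diff[OF G _ u] by (simp add: vector_ssub_ldistrib algebra_simps)
qed

lemma int_vec_expand: "v = (\<Sum>i\<in>UNIV. (v $ i) *s axis i (1::int))"
  by (simp add: vec_eq_iff axis_def if_distrib cong: if_cong)

lemma int_vec_induct: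
  fixes P :: "int^'d \<Rightarrow> bool"
  assumes zero: "P 0" and axis: "\<And>i. P (axis i 1)"
    and add: "\<And>u v. P u \<Longrightarrow> P v \<Longrightarrow> P (u + v)" and min: "\<And>u. P u \<Longrightarrow> P (- u)"
  shows "P v"
proof -
  have mult: "P (k *s axis i 1)" for k i
  proof (induction k rule: int_induct[where k = 0])
    case base
    show ?case using zero by simp
  next
    case (step1 k)
    then show ?case using add[OF _ axis] by (simp add: vector_sadd_rdistrib)
  next
    case (step2 k)
    then show ?case using add[OF _ min[OF axis[of i]], of "k *s axis i 1"]
      by (simp add: vector_ssub_ldistrib)
  qed
  have "P (\<Sum>i\<in>F. (v $ i) *s axis i 1)" if "finite F" for F
    using that by (induction F) (auto intro: zero add mult)
  then show ?thesis using int_vec_expand[of v] by (metis finite)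
qed

text \<open>Along each axis two multiples of the basis vector lie in the same coset, so some positive
  multiple of that vector lies in \<open>G\<close>; \<open>D\<close> is the product of these multipliers.\<close>

lemma finite_index_multiples:
  assumes G: "subgroup G (Zd :: (int^'d) monoid)" and fin: "finite (rcosets\<^bsub>Zd\<^esub> G)"
  obtains D :: int where "D > 0" "\<And>v. D *s v \<in> G"
proof -
  have "\<exists>n>0. n *s axis i (1::int) \<in> G" for i
  proof -
    define c where "c n = G #>\<^bsub>Zd\<^esub> (int n *s axis i 1)" for n
    have "range c \<subseteq> rcosets\<^bsub>Zd\<^esub> G" by (auto simp: c_def RCOSETS_def)
    then have "\<not> inj c" using fin finite_subset finite_imageD by blast
    then obtain m n where mn: "m < n" "c m = c n"
      by (metis injI linorder_neqE_nat)
    have "int n *s axis i 1 \<in> c n"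
      using Zd_subgroup_zero[OF G] by (force simp: c_def r_coset_def)
    then obtain h where "h \<in> G" "int n *s axis i 1 = h + int m *s axis i 1"
      unfolding mn(2)[symmetric] by (auto simp: c_def r_coset_def)
    then have "(int n - int m) *s axis i 1 \<in> G" by (simp add: vector_ssub_ldistrib)
    then show ?thesis using mn(1) by (intro exI[of _ "int n - int m"]) auto
  qed
  then obtain n where n: "\<And>i. n i > (0::int)" "\<And>i. n i *s axis i (1::int) \<in> G" by metis
  define D where "D = (\<Prod>i\<in>UNIV. n i)"
  have ax: "D *s axis i 1 \<in> G" for i
  proof -
    have "D = (\<Prod>j\<in>UNIV - {i}. n j) * n i"
      unfolding D_def by (simp add: prod.remove[of UNIV i] mult.commute)
    then show ?thesis using Zd_subgroup_scale[OF G n(2)]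
      by (metis vector_smult_assoc)
  qed
  have "D *s v \<in> G" for v
    by (induction v rule: int_vec_induct)
       (use ax Zd_subgroup_zero[OF G] Zd_subgroup_add[OF G] Zd_subgroup_minus[OF G] in
         \<open>auto simp: vector_add_ldistrib vector_smult_rneg\<close>)
  moreover have "D > 0" unfolding D_def using n(1) by (simp add: prod_pos)
  ultimately show thesis using that by blast
qed

lemma finite_int_box: "finite {v :: int^'d. \<forall>i. v $ i \<in> {a..b}}"
proof (rule finite_imageD)
  show "inj_on vec_nth {v :: int^'d. \<forall>i. v $ i \<in> {a..b}}"
    by (auto simp: inj_on_def vec_eq_iff)
  have "vec_nth ` {v :: int^'d. \<forall>i. v $ i \<in> {a..b}} \<subseteq> PiE UNIV (\<lambda>_. {a..b})" by auto
  then show "finite (vec_nth ` {v :: int^'d. \<forall>i. v $ i \<in> {a..b}})"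
    by (rule finite_subset) (simp add: finite_PiE)
qed

text \<open>Together with \<open>finite_int_box\<close> this reduces questions about functions that are
  periodic under \<open>D\<int>\<^sup>d\<close> to finitely many vectors.\<close>

lemma box_representative:
  fixes v :: "int^'d"
  assumes "D > 0"
  obtains u w where "v = u + D *s w" "\<forall>i. u $ i \<in> {0..D}"
proof
  show "v = (\<chi> i. v $ i mod D) + D *s (\<chi> i. v $ i div D)"
    by (simp add: vec_eq_iff)
  show "\<forall>i. (\<chi> i. v $ i mod D) $ i \<in> {0..D}"
    using assms by (simp add: less_imp_le)
qed

section \<open>Cones inside half spaces\<close>

text \<open>Up to a linear change of coordinates this region is the open positive orthant: the functionals
  \<open>x \<mapsto> l \<bullet> x + e x\<^sub>i\<close> form a basis of the dual space exactly when
  \<open>e + (\<Sum>i. l\<^sub>i) \<noteq> 0\<close>. As \<open>e\<close> tends to \<open>0\<close> the region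
  opens up towards the half space \<open>l \<bullet> x > 0\<close>, which is why this family of cones
  suffices below; \<open>l = 0\<close> gives the orthant itself.\<close>

lemma filled_cone_skewed_orthant:
  fixes l :: "real^'d" and e :: real
  assumes e: "e > 0" and nz: "e + (\<Sum>i\<in>UNIV. l $ i) \<noteq> 0"
  defines "F \<equiv> {x. \<forall>i. l \<bullet> x + e * x $ i > 0}"
  shows "filled_cone F" and "\<And>x y. x \<in> F \<Longrightarrow> y \<in> F \<Longrightarrow> x + y \<in> F"
proof -
  define a where "a i x = l \<bullet> x + e * x $ i" for i and x :: "real^'d"
  have a_inner: "a i x = (l + e *\<^sub>R axis i 1) \<bullet> x" for i x
    by (simp add: a_def inner_add_left inner_axis' )
  have a_add: "a i (x + y) = a i x + a i y" and a_scale: "a i (t *\<^sub>R x) = t * a i x" for i x y t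
    by (simp_all add: a_inner inner_add_right)
  have F: "F = {x. \<forall>i. a i x > 0}" by (simp add: F_def a_def)
  show add: "x \<in> F \<Longrightarrow> y \<in> F \<Longrightarrow> x + y \<in> F" for x y
    by (simp add: F a_add add_pos_pos)
  have cont: "continuous_on UNIV (a i)" for i
    unfolding a_def by (intro continuous_intros)
  have F_Inter: "F = (\<Inter>i. {x. a i x > 0})" by (auto simp: F)
  have "open {x. a i x > 0}" for i
    using open_Collect_less[OF continuous_on_const cont] .
  then have "open F" unfolding F_Inter by (intro open_INT) auto
  have "convex {x. a i x > 0}" for i
    unfolding a_inner by (rule convex_halfspace_gt)
  then have "convex F" unfolding F_Inter by (intro convex_INT)
  \<comment> \<open>Summing the equations \<open>a i x = y i\<close> with weights \<open>l $ i\<close> determines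
    \<open>s = l \<bullet> x\<close>, and then every coordinate of \<open>x\<close>.\<close>
  have solve: "\<exists>x. \<forall>i. a i x = y i" for y :: "'d \<Rightarrow> real"
  proof -
    define s where "s = (\<Sum>i\<in>UNIV. l $ i * y i) / (e + (\<Sum>i\<in>UNIV. l $ i))"
    define x :: "real^'d" where "x = (\<chi> i. (y i - s) / e)"
    have "s * (e + (\<Sum>i\<in>UNIV. l $ i)) = (\<Sum>i\<in>UNIV. l $ i * y i)"
      using nz by (simp add: s_def)
    then have "(\<Sum>i\<in>UNIV. l $ i * y i) - s * (\<Sum>i\<in>UNIV. l $ i) = s * e"
      by (simp add: distrib_left)
    moreover have "l \<bullet> x = ((\<Sum>i\<in>UNIV. l $ i * y i) - s * (\<Sum>i\<in>UNIV. l $ i)) / e"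
      by (simp add: inner_vec_def x_def sum_divide_distrib[symmetric] right_diff_distrib
          sum_subtractf sum_distrib_left mult.commute)
    ultimately have "l \<bullet> x = s * e / e" by simp
    then have "l \<bullet> x = s" using e by simp
    then have "a i x = y i" for i using e by (simp add: a_def x_def)
    then show ?thesis by blast
  qed
  define H where "H i = {x. (l + e *\<^sub>R axis i 1) \<bullet> x = 0}" for i
  have H: "H i = {x. a i x = 0}" for i by (simp add: H_def a_inner)
  obtain w where w: "\<And>i. a i w = 1" using solve[of "\<lambda>_. 1"] by blast
  have "\<exists>z. a i z = 0 \<and> (\<forall>j. j \<noteq> i \<longrightarrow> a j z = 1)" for i
    using solve[of "\<lambda>j. if j = i then 0 else 1"] by metis
  then obtain z where z: "\<And>i. a i (z i) = 0" "\<And>i j. j \<noteq> i \<Longrightarrow> a j (z i) = 1" by metis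
  have "inj H"
  proof (rule injI, rule ccontr)
    fix i j assume "H i = H j" "i \<noteq> j"
    moreover have "z i \<in> H i" using z(1) by (simp add: H)
    ultimately show False using z(2)[of j i] by (simp add: H)
  qed
  then have card: "card (range H) = CARD('d)" by (rule card_image)
  have hyper: "\<exists>b. b \<noteq> 0 \<and> H i = {x. b \<bullet> x = 0}" for i
  proof (intro exI conjI)
    show "l + e *\<^sub>R axis i 1 \<noteq> 0" using w[of i] unfolding a_inner by auto
  qed (simp add: H_def)
  have fr: "frontier F \<subseteq> \<Union> (range H)"
  proof
    fix x assume "x \<in> frontier F"
    then have x: "x \<in> closure F" "x \<notin> F"
      using \<open>open F\<close> by (auto simp: frontier_def interior_open)
    have "closure F \<subseteq> {x. a i x \<ge> 0}" for i
      by (rule closure_minimal) (auto simp: F less_imp_le intro: closed_Collect_le[OF continuous_on_const cont])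
    then have "a i x \<ge> 0" for i using x by auto
    moreover obtain i where "\<not> a i x > 0" using x(2) F by auto
    ultimately have "a i x = 0" by (meson order_antisym not_le)
    then show "x \<in> \<Union> (range H)" by (auto simp: H)
  qed
  \<comment> \<open>The part of the hyperplane \<open>H i\<close> on which the other functionals are positive is open in
    \<open>H i\<close>, and it is approached from inside \<open>F\<close> along the direction \<open>w\<close>.\<close>
  have face: "(top_of_set (H i)) interior_of (frontier F \<inter> H i) \<noteq> {}" for i
  proof -
    define V where "V = H i \<inter> {x. \<forall>j. j \<noteq> i \<longrightarrow> a j x > 0}"
    have "{x. \<forall>j. j \<noteq> i \<longrightarrow> a j x > 0} = (\<Inter>j\<in>-{i}. {x. a j x > 0})" by auto
    moreover have "open {x. a j x > 0}" for j
      using open_Collect_less[OF continuous_on_const cont] .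
    ultimately have "open {x. \<forall>j. j \<noteq> i \<longrightarrow> a j x > 0}" by (simp add: open_INT)
    then have "openin (top_of_set (H i)) V" unfolding V_def by (rule openin_open_Int)
    moreover have "V \<subseteq> frontier F \<inter> H i"
    proof
      fix x assume "x \<in> V"
      then have x: "a i x = 0" "\<And>j. j \<noteq> i \<Longrightarrow> a j x > 0" by (auto simp: V_def H)
      have "x \<in> closure F"
      proof (rule Lim_in_closed_set[OF closed_closure])
        have "((\<lambda>n. x + (1 / real (Suc n)) *\<^sub>R w) \<longlongrightarrow> x + 0 *\<^sub>R w) sequentially"
          by (intro tendsto_intros LIMSEQ_Suc lim_1_over_n)
        then show "((\<lambda>n. x + (1 / real (Suc n)) *\<^sub>R w) \<longlongrightarrow> x) sequentially" by simp
        have "x + (1 / real (Suc n)) *\<^sub>R w \<in> F" for n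
        proof -
          have "a j x \<ge> 0" for j using x by (metis less_eq_real_def)
          then have "a j x + 1 / real (Suc n) > 0" for j
            by (simp add: add_nonneg_pos)
          then show ?thesis by (simp add: F a_add a_scale w)
        qed
        then show "\<forall>\<^sub>F n in sequentially. x + (1 / real (Suc n)) *\<^sub>R w \<in> closure F"
          using closure_subset by (intro always_eventually) blast
      qed auto
      moreover have "x \<notin> F" using x(1) unfolding F by (metis (mono_tags) less_irrefl mem_Collect_eq)
      ultimately show "x \<in> frontier F \<inter> H i"
        using \<open>open F\<close> x(1) by (auto simp: frontier_def interior_open H)
    qed
    moreover have "z i \<in> V" using z by (simp add: V_def H)
    ultimately show ?thesis using interior_of_maximal by blast
  qed
  show "filled_cone F"
    unfolding filled_cone_def
    using \<open>open F\<close> convex_connected[OF \<open>convex F\<close>] card hyper fr face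
    by (intro conjI exI[of _ "range H"]) auto
qed

text \<open>A skewed orthant whose parameter \<open>e\<close> is small enough contains any given finite part of the
  open half space. The single value of \<open>e\<close> at which the functionals become dependent is avoided
  by having two candidates.\<close>

lemma lattice_cone_in_half_space:
  fixes l :: "real^'d" and P :: "(int^'d) set"
  assumes fin: "finite P" and pos: "\<And>v. v \<in> P \<Longrightarrow> l \<bullet> real_vec v > 0"
  obtains C where "lattice_cone C" "P \<subseteq> C"
proof -
  have "\<exists>e0>0. \<forall>v\<in>P. \<forall>i. \<forall>e. 0 < e \<and> e < e0 \<longrightarrow> l \<bullet> real_vec v + e * real_vec v $ i > 0"
  proof -
    define B where "B = 1 + (\<Sum>v\<in>P. norm (real_vec v))"
    define m where "m = Min (insert 1 ((\<lambda>v. l \<bullet> real_vec v) ` P))"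
    have "m > 0" using fin pos by (auto simp: m_def)
    have "B > 0" unfolding B_def by (simp add: add_pos_nonneg sum_nonneg)
    have "l \<bullet> real_vec v + e * real_vec v $ i > 0" if "v \<in> P" "0 < e" "e < m / B" for v i e
    proof -
      have "\<bar>real_vec v $ i\<bar> \<le> norm (real_vec v)" by (rule component_le_norm_cart)
      also have "\<dots> \<le> (\<Sum>v\<in>P. norm (real_vec v))" using fin that(1)
        by (intro member_le_sum[where f = "\<lambda>v. norm (real_vec v)"]) auto
      finally have "\<bar>real_vec v $ i\<bar> \<le> B" by (simp add: B_def)
      then have "- (e * real_vec v $ i) \<le> e * B" using that(2)
        by (metis abs_ge_minus_self order_trans mult_left_mono less_imp_le mult_minus_right)
      also have "\<dots> < m" using that(3) \<open>B > 0\<close> by (simp add: field_simps)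
      also have "m \<le> l \<bullet> real_vec v" using fin that(1) by (simp add: m_def)
      finally show ?thesis by simp
    qed
    then show ?thesis using \<open>m > 0\<close> \<open>B > 0\<close> by (intro exI[of _ "m / B"]) auto
  qed
  then obtain e0 where e0: "e0 > 0"
    "\<And>v i e. v \<in> P \<Longrightarrow> 0 < e \<Longrightarrow> e < e0 \<Longrightarrow> l \<bullet> real_vec v + e * real_vec v $ i > 0" by blast
  obtain e where e: "0 < e" "e < e0" "e + (\<Sum>i\<in>UNIV. l $ i) \<noteq> 0"
  proof (cases "e0 / 2 + (\<Sum>i\<in>UNIV. l $ i) = 0")
    case True
    then show thesis using that[of "e0 / 3"] e0(1) by linarith
  next
    case False
    then show thesis using that[of "e0 / 2"] e0(1) by simp
  qed
  define F where "F = {x. \<forall>i. l \<bullet> x + e * x $ i > 0}"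
  have "lattice_cone ({v. real_vec v \<in> F} - {0})"
    unfolding lattice_cone_def using filled_cone_skewed_orthant[OF e(1,3)] F_def by blast
  moreover have "P \<subseteq> {v. real_vec v \<in> F} - {0}"
  proof
    fix v assume v: "v \<in> P"
    have "real_vec (0 :: int^'d) = 0" by (simp add: real_vec_def vec_eq_iff)
    then have "v \<noteq> 0" using pos[OF v] by auto
    then show "v \<in> {v. real_vec v \<in> F} - {0}" using e0(2)[OF v e(1,2)] by (simp add: F_def)
  qed
  ultimately show thesis using that by blast
qed

section \<open>Straightening an equivariant bijection of the lattice\<close>

text \<open>Such a permutation moves every coset of \<open>G\<close> by one translation of the lattice, so it
  encodes a homeomorphism of an odometer that displaces each point within its orbit by a vector depending
  only on the coset of the point.\<close>

definition equivariant_perm :: "(int^'d) set \<Rightarrow> (int^'d \<Rightarrow> int^'d) \<Rightarrow> bool" where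
  "equivariant_perm G \<pi> \<longleftrightarrow> bij \<pi> \<and> (\<forall>v. \<forall>g\<in>G. \<pi> (v + g) = \<pi> v + g)"

lemma real_vec_simps [simp]:
  "real_vec (u + v) = real_vec u + real_vec v" "real_vec (u - v) = real_vec u - real_vec v"
  "real_vec 0 = 0" "real_vec (k *s v) = real_of_int k *\<^sub>R real_vec v"
  "real_vec (axis i 1) = axis i 1" "real_vec v $ i = real_of_int (v $ i)"
  by (simp_all add: real_vec_def vec_eq_iff axis_def)

text \<open>For a function \<open>q\<close> of the lattice that is equivariant along a finite-index
  subgroup, the translation part \<open>A\<close> is a homomorphism on \<open>G\<close>, and \<open>q\<close> stays within
  bounded distance of the linear extension of \<open>A\<close>.\<close>

context
  fixes G :: "(int^'d) set" and D :: int and q A :: "int^'d \<Rightarrow> int^'d"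
  assumes G: "subgroup G Zd" and D: "D > 0" "\<And>v. D *s v \<in> G"
    and q: "\<And>v g. g \<in> G \<Longrightarrow> q (v + g) = q v + A g"
begin

lemma translation_part_add: "g \<in> G \<Longrightarrow> h \<in> G \<Longrightarrow> A (g + h) = A g + A h"
  using q[of "g + h" 0] q[of h "0 + g"] q[of g 0] Zd_subgroup_add[OF G] by (simp add: add.assoc)

lemma translation_part_zero: "A 0 = 0"
  using translation_part_add[of 0 0] Zd_subgroup_zero[OF G] by simp

lemma translation_part_minus: "g \<in> G \<Longrightarrow> A (- g) = - A g"
  using translation_part_add[of g "- g"] translation_part_zero Zd_subgroup_minus[OF G] by (simp add: eq_neg_iff_add_eq_0 add.commute)

lemma translation_part_scale: "g \<in> G \<Longrightarrow> A (k *s g) = k *s A g"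
proof (induction k rule: int_induct[where k = 0])
  case base
  show ?case using translation_part_zero by simp
next
  case (step1 i)
  then show ?case using translation_part_add[OF Zd_subgroup_scale[OF G step1(3)] step1(3)]
    by (simp add: vector_sadd_rdistrib)
next
  case (step2 i)
  then show ?case
    using translation_part_add[OF Zd_subgroup_scale[OF G step2(3), of i] Zd_subgroup_minus[OF G step2(3)]]
      translation_part_minus by (simp add: vector_ssub_ldistrib)
qed

lemma translation_part_real_extension:
  obtains L where "linear L" "\<And>g. g \<in> G \<Longrightarrow> L (real_vec g) = real_vec (A g)"
proof
  define L :: "real^'d \<Rightarrow> real^'d"
    where "L x = (\<Sum>i\<in>UNIV. (x $ i / D) *\<^sub>R real_vec (A (D *s axis i 1)))" for x
  show "linear L"
    by (rule linearI) (simp_all add: L_def add_divide_distrib scaleR_add_left sum.distrib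
        scaleR_sum_right)
  fix g assume g: "g \<in> G"
  have sum_A: "A (\<Sum>i\<in>F. (g $ i) *s (D *s axis i 1)) = (\<Sum>i\<in>F. (g $ i) *s A (D *s axis i 1))
      \<and> (\<Sum>i\<in>F. (g $ i) *s (D *s axis i 1)) \<in> G" if "finite F" for F
    using that
  proof (induction F)
    case (insert i F)
    then show ?case
      using translation_part_add[OF Zd_subgroup_scale[OF G D(2)[of "axis i 1"]], of "\<Sum>i\<in>F. (g $ i) *s (D *s axis i 1)"]
        translation_part_scale[OF D(2)] Zd_subgroup_add[OF G Zd_subgroup_scale[OF G D(2)]] by simp
  qed (simp add: translation_part_zero Zd_subgroup_zero[OF G])
  have "D *s g = (\<Sum>i\<in>UNIV. (g $ i) *s (D *s axis i 1))"
    by (simp add: vec_eq_iff axis_def if_distrib cong: if_cong)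
  then have "D *s A g = (\<Sum>i\<in>UNIV. (g $ i) *s A (D *s axis i 1))"
    using sum_A[of UNIV] translation_part_scale[OF g, of D] by simp
  then have eq: "real_vec (D *s A g) = real_vec (\<Sum>i\<in>UNIV. (g $ i) *s A (D *s axis i 1))" by simp
  have rsum: "real_vec (\<Sum>i\<in>F. f i) = (\<Sum>i\<in>F. real_vec (f i))" if "finite F" for F and f :: "'d \<Rightarrow> int^'d"
    using that by (induction F) auto
  have "of_int D *\<^sub>R L (real_vec g) = (\<Sum>i\<in>UNIV. real_of_int (g $ i) *\<^sub>R real_vec (A (D *s axis i 1)))"
    using D(1) by (simp add: L_def scaleR_sum_right)
  also have "\<dots> = of_int D *\<^sub>R real_vec (A g)" using eq by (simp add: rsum)
  finally show "L (real_vec g) = real_vec (A g)" using D(1) by simp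
qed

text \<open>The extension \<open>L\<close> of \<open>A\<close> to real vectors is onto. Since \<open>q\<close> is onto, every
  multiple of a basis vector is a value of \<open>q\<close> on the box plus a vector in the range of
  \<open>L\<close>. The box is finite, so two different multiples share the same box vector, and their
  difference shows that the basis vector itself lies in that range.\<close>

lemma translation_part_real_left_inverse:
  assumes "surj q"
  obtains B where "linear B" "\<And>g. g \<in> G \<Longrightarrow> B (real_vec (A g)) = real_vec g"
proof -
  obtain L where L: "linear L" "\<And>g. g \<in> G \<Longrightarrow> L (real_vec g) = real_vec (A g)"
    using translation_part_real_extension by blast
  define Box :: "(int^'d) set" where "Box = {u. \<forall>i. u $ i \<in> {0..D}}"
  have "finite Box" unfolding Box_def by (rule finite_int_box)
  have "axis i 1 \<in> range L" for i
  proof -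
    have "\<exists>u\<in>Box. \<exists>w. q (u + D *s w) = int n *s axis i 1" for n
    proof -
      obtain v where v: "q v = int n *s axis i 1" using assms by (metis surjD)
      obtain u w where "v = u + D *s w" "\<forall>i. u $ i \<in> {0..D}" using box_representative[OF D(1)] by blast
      then show ?thesis using v by (auto simp: Box_def)
    qed
    then obtain u w where uw: "\<And>n. u n \<in> Box" "\<And>n. q (u n + D *s w n) = int n *s axis i 1" by metis
    have "finite (range u)" using \<open>finite Box\<close> uw(1) by (auto intro: finite_subset)
    then have "\<not> inj u" using finite_imageD by blast
    then obtain m n where mn: "m < n" "u m = u n" by (metis injI linorder_neqE_nat)
    have "q (u n) + A (D *s w n) = int n *s axis i 1" "q (u n) + A (D *s w m) = int m *s axis i 1"
      using uw(2)[of n] uw(2)[of m] q[OF D(2)] mn(2) by auto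
    then have "A (D *s w n) - A (D *s w m) = int n *s axis i 1 - int m *s axis i 1"
      by (metis add_diff_cancel_left)
    then have "real_vec (A (D *s w n)) - real_vec (A (D *s w m))
        = real_vec (int n *s axis i 1 - int m *s axis i 1)"
      by (simp only: real_vec_simps(2)[symmetric])
    then have "L (real_vec (D *s w n)) - L (real_vec (D *s w m)) = (real n - real m) *\<^sub>R axis i 1"
      unfolding L(2)[OF D(2)] by (simp add: scaleR_left_diff_distrib)
    then have "L ((1 / (real n - real m)) *\<^sub>R (real_vec (D *s w n) - real_vec (D *s w m))) = axis i 1"
      using mn(1) unfolding linear_cmul[OF L(1)] linear_diff[OF L(1)] by simp
    then show ?thesis by (rule range_eqI[OF sym])
  qed
  then have "Basis \<subseteq> range L" by (auto simp: Basis_vec_def)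
  moreover have "subspace (range L)" using L(1) by (simp add: linear_subspace_image)
  ultimately have "surj L" by (metis span_Basis span_minimal top.extremum_uniqueI)
  then obtain B where B: "linear B" "L \<circ> B = id"
    using linear_surjective_right_inverse[OF L(1)] by blast
  then have "B \<circ> L = id" using linear_inverse_left[OF L(1) B(1)] by blast
  then have "B (real_vec (A g)) = real_vec g" if "g \<in> G" for g
    using pointfree_idE[OF \<open>B \<circ> L = id\<close>] by (simp flip: L(2)[OF that])
  with B(1) show thesis using that by blast
qed

text \<open>Pull a linear functional \<open>f\<close> back along \<open>q\<close> by
  means of the linear part of \<open>q\<close>, and call the result \<open>\<phi>\<close>. Then
  \<open>\<phi> - f\<close> is constant on cosets of \<open>G\<close>, and moving a coset by \<open>g0 \<in> G\<close> with
  \<open>f g0 = D\<close> changes this constant by \<open>D\<close>. Moving every coset by a suitable multiple of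
  \<open>g0\<close> therefore achieves \<open>f \<le> \<phi> \<circ> \<pi> < f + D\<close>. If \<open>f\<close> grows by at least
  \<open>D\<close> along each basis vector, then \<open>\<phi> \<circ> \<pi>\<close> grows strictly. In dimension at
  least two both demands on \<open>f\<close> can be met: \<open>D\<close> times the coordinate sum plus one further
  coordinate takes the value \<open>D\<close> on \<open>D (e\<^sub>b - e\<^sub>a)\<close>, a vector on which the
  coordinate sum vanishes.\<close>

lemma monotone_rearrangement:
  assumes surj: "surj q" and d: "CARD('d) \<noteq> 1"
  obtains \<pi> and l :: "real^'d" where "equivariant_perm G \<pi>"
    "\<And>u i. l \<bullet> real_vec (q (\<pi> (u + axis i 1)) - q (\<pi> u)) > 0"
proof -
  obtain B where B: "linear B" "\<And>g. g \<in> G \<Longrightarrow> B (real_vec (A g)) = real_vec g"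
    using translation_part_real_left_inverse[OF surj] by blast
  obtain a b :: 'd where ab: "a \<noteq> b"
  proof -
    have "\<not> (\<forall>a b :: 'd. a = b)"
      using d card_1_singleton_iff[of "UNIV :: 'd set"] by (metis UNIV_eq_I singletonI One_nat_def)
    then show thesis using that by blast
  qed
  define f :: "real^'d \<Rightarrow> real" where "f x = of_int D * (\<Sum>i\<in>UNIV. x $ i) + x $ b" for x
  have f: "linear f"
    by (rule linearI) (simp_all add: f_def sum.distrib algebra_simps sum_distrib_left)
  define g0 :: "int^'d" where "g0 = D *s (axis b 1 - axis a 1)"
  have "g0 \<in> G" unfolding g0_def by (rule D(2))
  have sum_axis: "(\<Sum>i\<in>UNIV. axis j (1::real) $ i) = 1" for j :: 'd
    by (simp add: axis_def)
  have f_g0: "f (real_vec g0) = D"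
    using ab by (simp add: g0_def f_def sum_distrib_left[symmetric] sum_subtractf sum_axis)
       (simp add: axis_def)
  have f_axis: "f (axis i 1) \<ge> D" for i
    unfolding f_def sum_axis by (simp add: axis_def)
  define \<phi> where "\<phi> v = f (B (real_vec (q v)))" for v
  have \<phi>: "\<phi> (v + g) = \<phi> v + f (real_vec g)" if "g \<in> G" for v g
    using that by (simp add: \<phi>_def q B linear_add[OF B(1)] linear_add[OF f])
  define k where "k v = - \<lfloor>(\<phi> v - f (real_vec v)) / D\<rfloor>" for v
  have k: "k (v + g) = k v" if "g \<in> G" for v g
    using that by (simp add: k_def \<phi> linear_add[OF f])
  define \<pi> where "\<pi> v = v + k v *s g0" for v
  have k': "k (v + j *s g0) = k v" for v j
    using k Zd_subgroup_scale[OF G \<open>g0 \<in> G\<close>] by blast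
  have "bij \<pi>"
  proof (rule bij_betw_byWitness[where f' = "\<lambda>v. v - k v *s g0"])
    show "\<forall>v\<in>UNIV. \<pi> v - k (\<pi> v) *s g0 = v" by (simp add: \<pi>_def k')
    have "k (v - k v *s g0) = k v" for v
      using k'[of v "- k v"] by (simp add: vector_smult_lneg)
    then show "\<forall>v\<in>UNIV. \<pi> (v - k v *s g0) = v" by (simp add: \<pi>_def)
  qed auto
  then have perm: "equivariant_perm G \<pi>"
    by (simp add: equivariant_perm_def \<pi>_def k)
  \<comment> \<open>The multiplier \<open>k v\<close> replaces \<open>(\<phi> - f) / D\<close> by its fractional part.\<close>
  have \<phi>\<pi>: "f (real_vec v) \<le> \<phi> (\<pi> v)" "\<phi> (\<pi> v) < f (real_vec v) + D" for v
  proof -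
    have "\<phi> (\<pi> v) = \<phi> v + k v * D"
      unfolding \<pi>_def \<phi>[OF Zd_subgroup_scale[OF G \<open>g0 \<in> G\<close>]]
      by (simp add: linear_cmul[OF f] f_g0)
    moreover have "\<phi> v - f (real_vec v) + k v * D = D * frac ((\<phi> v - f (real_vec v)) / D)"
    proof -
      have "D * frac x = D * x + (- \<lfloor>x\<rfloor>) * D" for x :: real by (simp add: frac_def algebra_simps)
      then show ?thesis using D(1) by (simp add: k_def)
    qed
    ultimately have "\<phi> (\<pi> v) = f (real_vec v) + D * frac ((\<phi> v - f (real_vec v)) / D)" by simp
    then show "f (real_vec v) \<le> \<phi> (\<pi> v)" "\<phi> (\<pi> v) < f (real_vec v) + D"
      using D(1) frac_lt_1[of "(\<phi> v - f (real_vec v)) / D"] by (simp_all add: frac_ge_0)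
  qed
  define l where "l = adjoint (f \<circ> B) 1"
  have l: "l \<bullet> x = f (B x)" for x
    using adjoint_works[OF linear_compose[OF B(1) f], of x 1] by (simp add: l_def inner_commute)
  have "l \<bullet> real_vec (q (\<pi> (u + axis i 1)) - q (\<pi> u)) > 0" for u i
  proof -
    have "l \<bullet> real_vec (q (\<pi> (u + axis i 1)) - q (\<pi> u)) = \<phi> (\<pi> (u + axis i 1)) - \<phi> (\<pi> u)"
      by (simp add: l \<phi>_def linear_diff[OF B(1)] linear_diff[OF f])
    moreover have "f (real_vec (u + axis i 1)) = f (real_vec u) + f (axis i 1)"
      by (simp add: linear_add[OF f])
    ultimately show ?thesis
      using \<phi>\<pi>(1)[of "u + axis i 1"] \<phi>\<pi>(2)[of u] f_axis[of i] by linarith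
  qed
  with perm show thesis using that by blast
qed

end

text \<open>\<open>Q\<close> induces a bijection from the residues modulo \<open>n\<close> to the residues modulo
  \<open>\<bar>a\<bar>\<close>.\<close>

lemma periodic_int_bij_abs_eq:
  fixes Q :: "int \<Rightarrow> int"
  assumes "bij Q" "n > 0" and Q: "\<And>k. Q (k + n) = Q k + a"
  shows "\<bar>a\<bar> = n"
proof -
  have inj: "Q x = Q y \<Longrightarrow> x = y" for x y using \<open>bij Q\<close> by (simp add: bij_def inj_eq)
  have mult: "Q (k + j * n) = Q k + j * a" for k j
  proof (induction j rule: int_induct[where k = 0])
    case (step1 i)
    then show ?case using Q[of "k + i * n"] by (simp add: algebra_simps)
  next
    case (step2 i)
    then show ?case using Q[of "k + i * n - n"] by (simp add: algebra_simps)
  qed simp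
  have "a \<noteq> 0" using inj[of n 0] Q[of 0] \<open>n > 0\<close> by auto
  have "bij_betw (\<lambda>k. Q k mod \<bar>a\<bar>) {0..<n} {0..<\<bar>a\<bar>}"
    unfolding bij_betw_def
  proof
    show "inj_on (\<lambda>k. Q k mod \<bar>a\<bar>) {0..<n}"
    proof (rule inj_onI)
      fix x y assume xy: "x \<in> {0..<n}" "y \<in> {0..<n}" "Q x mod \<bar>a\<bar> = Q y mod \<bar>a\<bar>"
      then have "a dvd Q x - Q y" by (simp add: mod_eq_dvd_iff)
      then obtain j where "Q x = Q y + j * a" by (metis dvdE mult.commute diff_add_cancel add.commute)
      then have "x = y + j * n" using mult inj by metis
      then have "x mod n = y mod n" by simp
      then show "x = y" using xy by simp
    qed
    show "(\<lambda>k. Q k mod \<bar>a\<bar>) ` {0..<n} = {0..<\<bar>a\<bar>}"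
    proof
      show "(\<lambda>k. Q k mod \<bar>a\<bar>) ` {0..<n} \<subseteq> {0..<\<bar>a\<bar>}" using \<open>a \<noteq> 0\<close> by auto
      show "{0..<\<bar>a\<bar>} \<subseteq> (\<lambda>k. Q k mod \<bar>a\<bar>) ` {0..<n}"
      proof
        fix r assume r: "r \<in> {0..<\<bar>a\<bar>}"
        obtain m where m: "Q m = r" using \<open>bij Q\<close> by (metis bij_pointE)
        have "Q m = Q (m mod n) + (m div n) * a" using mult[of "m mod n" "m div n"] by simp
        then have "Q (m mod n) mod \<bar>a\<bar> = Q m mod \<bar>a\<bar>" by (simp add: mod_eq_dvd_iff)
        then have "Q (m mod n) mod \<bar>a\<bar> = r" using m r by simp
        then show "r \<in> (\<lambda>k. Q k mod \<bar>a\<bar>) ` {0..<n}" using \<open>n > 0\<close> by (intro image_eqI[of _ _ "m mod n"]) auto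
      qed
    qed
  qed
  then show ?thesis using bij_betw_same_card \<open>n > 0\<close> by fastforce
qed

text \<open>With a single axis every nonzero functional is injective, so cosets cannot be shifted by a vector
  that is short for the functional. Instead rigidity helps: counting residues shows that the translation part of \<open>q\<close> is plus or minus the
  identity, so \<open>q\<close> can be rearranged into \<open>v \<mapsto> \<sigma> v\<close> with
  \<open>\<sigma> = \<plusminus>1\<close>.\<close>

lemma monotone_rearrangement_dim_one:
  fixes G :: "(int^'d) set" and D :: int and q A :: "int^'d \<Rightarrow> int^'d"
  assumes G: "subgroup G Zd" and D: "D > 0" "\<And>v. D *s v \<in> G"
    and q: "\<And>v g. g \<in> G \<Longrightarrow> q (v + g) = q v + A g"
    and bij: "bij q" and d: "CARD('d) = 1"
  obtains \<pi> and l :: "real^'d" where "equivariant_perm G \<pi>"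
    "\<And>u i. l \<bullet> real_vec (q (\<pi> (u + axis i 1)) - q (\<pi> u)) > 0"
proof -
  obtain i0 :: 'd where i0: "UNIV = {i0}" using d by (meson card_1_singletonE)
  then have eq: "i = i0" for i by auto
  have vec_eq: "v = w \<longleftrightarrow> v $ i0 = w $ i0" for v w :: "int^'d"
    unfolding vec_eq_iff by (metis eq)
  define e :: "int^'d" where "e = axis i0 1"
  have e: "e $ i0 = 1" by (simp add: e_def)
  define Q where "Q n = q (n *s e) $ i0" for n
  have "bij Q"
  proof (rule bijI)
    show "inj Q"
      using bij by (auto simp: inj_def bij_def Q_def vec_eq[symmetric]) (metis e mult.right_neutral vector_smult_component)
    show "surj Q"
    proof (rule surjI[where f = "\<lambda>m. inv_into UNIV q (m *s e) $ i0"])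
      fix m
      obtain v where v: "q v = m *s e" using bij by (metis bij_pointE)
      have "v = (v $ i0) *s e" by (simp add: vec_eq e)
      then show "Q (inv_into UNIV q (m *s e) $ i0) = m"
        using v bij unfolding Q_def by (metis bij_inv_eq_iff e mult.right_neutral vector_smult_component)
    qed
  qed
  define \<sigma> where "\<sigma> = sgn (A (D *s e) $ i0)"
  have "Q (k + D) = Q k + A (D *s e) $ i0" for k
    using q[OF D(2)] by (simp add: Q_def vector_sadd_rdistrib)
  then have "\<bar>A (D *s e) $ i0\<bar> = D" using periodic_int_bij_abs_eq[OF \<open>bij Q\<close> D(1)] by blast
  then have AD: "A (D *s e) $ i0 = \<sigma> * D" and \<sigma>: "\<sigma> * \<sigma> = 1"
    using D(1) by (auto simp: \<sigma>_def sgn_if abs_if split: if_splits)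
  have A: "A g = \<sigma> *s g" if g: "g \<in> G" for g
  proof -
    have "D *s A g = A (D *s g)" using translation_part_scale[OF G D q g] by simp
    also have "D *s g = (g $ i0) *s (D *s e)" by (simp add: vec_eq e)
    also have "A \<dots> = (g $ i0) *s A (D *s e)" using translation_part_scale[OF G D q D(2)] by simp
    finally show ?thesis using D(1) AD by (simp add: vec_eq algebra_simps)
  qed
  define \<pi> where "\<pi> v = inv_into UNIV q (\<sigma> *s v)" for v
  have q\<pi>: "q (\<pi> v) = \<sigma> *s v" for v using bij by (simp add: \<pi>_def bij_is_surj surj_f_inv_f)
  have "bij \<pi>"
  proof (rule bij_betw_byWitness[where f' = "\<lambda>v. \<sigma> *s q v"])
    show "\<forall>v\<in>UNIV. \<sigma> *s q (\<pi> v) = v" using \<sigma> by (simp add: q\<pi> vector_smult_assoc)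
    show "\<forall>v\<in>UNIV. \<pi> (\<sigma> *s q v) = v"
      using \<sigma> bij by (simp add: \<pi>_def vector_smult_assoc bij_is_inj)
  qed auto
  moreover have "\<pi> (v + g) = \<pi> v + g" if "g \<in> G" for v g
  proof -
    have "q (\<pi> v + g) = q (\<pi> (v + g))" using that by (simp add: q q\<pi> A vector_add_ldistrib)
    then show ?thesis using bij by (simp add: bij_def inj_eq)
  qed
  ultimately have "equivariant_perm G \<pi>" by (simp add: equivariant_perm_def)
  moreover have "real_vec (\<sigma> *s e) \<bullet> real_vec (q (\<pi> (u + axis i 1)) - q (\<pi> u)) > 0" for u i
  proof -
    have "q (\<pi> (u + axis i 1)) - q (\<pi> u) = \<sigma> *s e"
      by (simp add: q\<pi> e_def eq[of i] vector_add_ldistrib)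
    moreover have "\<sigma> *s e \<noteq> 0" using \<sigma> e by (auto simp: vec_eq)
    then have "real_vec (\<sigma> *s e) \<noteq> 0" by (auto simp: vec_eq_iff)
    ultimately show ?thesis by (simp only: inner_gt_zero_iff not_False_eq_True)
  qed
  ultimately show thesis using that by blast
qed

text \<open>The steps of \<open>q \<circ> \<pi>\<close> are periodic along \<open>G\<close>, so there are only finitely
  many of them; all lie in one open half space, hence in a cone.\<close>

lemma cone_steps_rearrangement:
  fixes G :: "(int^'d) set" and D :: int and q A :: "int^'d \<Rightarrow> int^'d"
  assumes G: "subgroup G Zd" and D: "D > 0" "\<And>v. D *s v \<in> G"
    and q: "\<And>v g. g \<in> G \<Longrightarrow> q (v + g) = q v + A g" and bij: "bij q"
  obtains \<pi> C where "equivariant_perm G \<pi>" "lattice_cone C"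
    "\<And>u i. q (\<pi> (u + axis i 1)) - q (\<pi> u) \<in> C"
proof -
  obtain \<pi> and l :: "real^'d" where \<pi>: "equivariant_perm G \<pi>"
    "\<And>u i. l \<bullet> real_vec (q (\<pi> (u + axis i 1)) - q (\<pi> u)) > 0"
  proof (cases "CARD('d) = 1")
    case True
    show thesis using monotone_rearrangement_dim_one[OF G D q bij True] that by blast
  next
    case False
    show thesis using monotone_rearrangement[OF G D q bij_is_surj[OF bij] False] that by blast
  qed
  define s where "s u i = q (\<pi> (u + axis i 1)) - q (\<pi> u)" for u i
  define P where "P = (\<lambda>(u, i). s u i) ` ({u. \<forall>i. u $ i \<in> {0..D}} \<times> UNIV)"
  have s_per: "s (u + g) i = s u i" if g: "g \<in> G" for u g i
  proof -
    have "u + g + axis i 1 = u + axis i 1 + g" by simp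
    then show ?thesis
      using \<pi>(1) q[OF g] g by (simp only: s_def equivariant_perm_def) (simp add: add.assoc)
  qed
  have s_P: "s u i \<in> P" for u i
  proof -
    obtain u' w where "u = u' + D *s w" "\<forall>i. u' $ i \<in> {0..D}" using box_representative[OF D(1)] by blast
    then show ?thesis using s_per[OF D(2)] by (auto simp: P_def)
  qed
  have "finite P" unfolding P_def by (intro finite_imageI finite_cartesian_product finite_int_box finite)
  then obtain C where "lattice_cone C" "P \<subseteq> C"
    using lattice_cone_in_half_space[of P l] \<pi>(2) by (force simp: P_def s_def)
  then show thesis using that[OF \<pi>(1), of C] s_P unfolding s_def by blast
qed

section \<open>Odometers\<close>

lemma Zd_rcoset_mem_iff:
  assumes G: "subgroup G (Zd :: (int^'d) monoid)" and K: "K \<in> rcosets\<^bsub>Zd\<^esub> G" and u: "u \<in> K"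
  shows "w \<in> K \<longleftrightarrow> w - u \<in> G"
proof -
  obtain a where a: "K = (\<lambda>h. h + a) ` G" using K by (auto simp: RCOSETS_def r_coset_def)
  then obtain h where h: "h \<in> G" "u = h + a" using u by blast
  have "w \<in> K \<longleftrightarrow> w - a \<in> G" unfolding a by (auto intro: image_eqI[of _ _ "w - a"])
  also have "\<dots> \<longleftrightarrow> w - u \<in> G"
    using Zd_subgroup_add[OF G _ h(1), of "w - u"] Zd_subgroup_diff[OF G _ h(1), of "w - a"]
    by (auto simp: h(2) algebra_simps)
  finally show ?thesis .
qed

lemma Zd_rcoset_nonempty:
  assumes "subgroup G (Zd :: (int^'d) monoid)" "K \<in> rcosets\<^bsub>Zd\<^esub> G"
  shows "K \<noteq> {}"
  using assms subgroup.rcosets_non_empty by blast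

lemma Zd_rcosets_eqI:
  assumes G: "subgroup G (Zd :: (int^'d) monoid)"
    and K: "K \<in> rcosets\<^bsub>Zd\<^esub> G" "L \<in> rcosets\<^bsub>Zd\<^esub> G" and u: "u \<in> K" "u \<in> L"
  shows "K = L"
  using Zd_rcoset_mem_iff[OF G K(1) u(1)] Zd_rcoset_mem_iff[OF G K(2) u(2)] by blast

lemma Zd_rcoset_shift:
  "K #>\<^bsub>Zd\<^esub> v = (\<lambda>u. u + v) ` K" for v :: "int^'d"
  by (auto simp: r_coset_def)

lemma Zd_rcoset_shift_in_rcosets:
  fixes v :: "int^'d"
  assumes "K \<in> rcosets\<^bsub>Zd\<^esub> G" shows "K #>\<^bsub>Zd\<^esub> v \<in> rcosets\<^bsub>Zd\<^esub> G"
proof -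
  obtain a where "K = G #>\<^bsub>Zd\<^esub> a" using assms by (auto simp: RCOSETS_def)
  then have "K #>\<^bsub>Zd\<^esub> v = G #>\<^bsub>Zd\<^esub> (a + v)"
    by (auto simp: Zd_rcoset_shift image_image add.assoc)
  then show ?thesis by (auto simp: RCOSETS_def)
qed

lemma finite_rcosets_if_multiples:
  fixes G :: "(int^'d) set"
  assumes G: "subgroup G Zd" and D: "D > 0" "\<And>v. D *s v \<in> G"
  shows "finite (rcosets\<^bsub>Zd\<^esub> G)"
proof (rule finite_surj[OF finite_int_box])
  show "rcosets\<^bsub>Zd\<^esub> G \<subseteq> (\<lambda>u. G #>\<^bsub>Zd\<^esub> u) ` {u. \<forall>i. u $ i \<in> {0..D}}"
  proof
    fix K assume K: "K \<in> rcosets\<^bsub>Zd\<^esub> G"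
    then obtain v where v: "v \<in> K" using Zd_rcoset_nonempty[OF G] by blast
    obtain u w where uw: "v = u + D *s w" "\<forall>i. u $ i \<in> {0..D}" using box_representative[OF D(1)] by blast
    have "v - u \<in> G" using uw(1) D(2) by simp
    then have "v \<in> G #>\<^bsub>Zd\<^esub> u" by (auto simp: Zd_rcoset_shift intro: image_eqI[of _ _ "v - u"])
    moreover have "G #>\<^bsub>Zd\<^esub> u \<in> rcosets\<^bsub>Zd\<^esub> G" by (auto simp: RCOSETS_def)
    ultimately have "K = G #>\<^bsub>Zd\<^esub> u" using Zd_rcosets_eqI[OF G K _ v] by blast
    then show "K \<in> (\<lambda>u. G #>\<^bsub>Zd\<^esub> u) ` {u. \<forall>i. u $ i \<in> {0..D}}" using uw(2) by blast
  qed
qed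

context
  fixes G :: "nat \<Rightarrow> (int^'d) set"
  assumes G: "odometer_groups G"
begin

lemma odometer_group: "subgroup (G j) Zd" and odometer_group_finite_index: "finite (rcosets\<^bsub>Zd\<^esub> (G j))"
  using G by (auto simp: odometer_groups_def)

lemma odometer_group_mono: "i \<le> j \<Longrightarrow> G j \<subseteq> G i"
  using G by (auto simp: odometer_groups_def decseq_def)

text \<open>Coherence of a sequence of cosets just means that it is decreasing. This form is easier to work
  with than the product of a group and a coset.\<close>

lemma odometer_set_iff:
  "x \<in> odometer_set G \<longleftrightarrow> (\<forall>j. x j \<in> rcosets\<^bsub>Zd\<^esub> (G j) \<and> x (Suc j) \<subseteq> x j)"
proof -
  have "x j = G j <#>\<^bsub>Zd\<^esub> x (Suc j) \<longleftrightarrow> x (Suc j) \<subseteq> x j"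
    if x: "x j \<in> rcosets\<^bsub>Zd\<^esub> (G j)" "x (Suc j) \<in> rcosets\<^bsub>Zd\<^esub> (G (Suc j))" for j
  proof
    assume "x j = G j <#>\<^bsub>Zd\<^esub> x (Suc j)"
    moreover have "x (Suc j) \<subseteq> G j <#>\<^bsub>Zd\<^esub> x (Suc j)"
      using Zd_subgroup_zero[OF odometer_group[of j]] by (force simp: set_mult_def)
    ultimately show "x (Suc j) \<subseteq> x j" by simp
  next
    assume sub: "x (Suc j) \<subseteq> x j"
    obtain u where u: "u \<in> x (Suc j)" using x(2) Zd_rcoset_nonempty[OF odometer_group] by blast
    have uj: "u \<in> x j" using u sub by blast
    show "x j = G j <#>\<^bsub>Zd\<^esub> x (Suc j)"
    proof
      show "x j \<subseteq> G j <#>\<^bsub>Zd\<^esub> x (Suc j)"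
      proof
        fix w assume "w \<in> x j"
        then have "w - u \<in> G j" using Zd_rcoset_mem_iff[OF odometer_group x(1) uj] by blast
        then show "w \<in> G j <#>\<^bsub>Zd\<^esub> x (Suc j)" using u by (force simp: set_mult_def)
      qed
      show "G j <#>\<^bsub>Zd\<^esub> x (Suc j) \<subseteq> x j"
      proof
        fix w assume "w \<in> G j <#>\<^bsub>Zd\<^esub> x (Suc j)"
        then obtain g y where gy: "g \<in> G j" "y \<in> x (Suc j)" "w = g + y" by (auto simp: set_mult_def)
        then have "y \<in> x j" using sub by blast
        then show "w \<in> x j" using Zd_rcoset_mem_iff[OF odometer_group x(1)] gy by force
      qed
    qed
  qed
  then show ?thesis by (auto simp: odometer_set_def)
qed

lemma odometer_coset: "x \<in> odometer_set G \<Longrightarrow> x j \<in> rcosets\<^bsub>Zd\<^esub> (G j)"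
  by (simp add: odometer_set_iff)

lemma odometer_coset_antimono: "x \<in> odometer_set G \<Longrightarrow> i \<le> j \<Longrightarrow> x j \<subseteq> x i"
  by (rule lift_Suc_antimono_le[of x]) (auto simp: odometer_set_iff)

lemma odometer_coordinate_determines_earlier:
  assumes x: "x \<in> odometer_set G" and y: "y \<in> odometer_set G" and ij: "i \<le> j" and eq: "x j = y j"
  shows "x i = y i"
proof -
  obtain u where "u \<in> x j" using Zd_rcoset_nonempty[OF odometer_group odometer_coset[OF x]] by blast
  then have "u \<in> x i" "u \<in> y i"
    using odometer_coset_antimono[OF x ij] odometer_coset_antimono[OF y ij] eq by auto
  then show ?thesis
    using Zd_rcosets_eqI[OF odometer_group odometer_coset[OF x] odometer_coset[OF y]] by blast
qed

lemma topspace_odometer_space: "topspace (odometer_space G) = odometer_set G"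
  using odometer_coset by (auto simp: odometer_space_def PiE_iff)

lemma odometer_set_nonempty: "odometer_set G \<noteq> {}"
proof -
  have "G j \<in> rcosets\<^bsub>Zd\<^esub> (G j)" for j
    unfolding RCOSETS_def by (auto simp: Zd_rcoset_shift intro!: exI[of _ 0])
  then have "G \<in> odometer_set G" using odometer_group_mono by (simp add: odometer_set_iff)
  then show ?thesis by blast
qed

lemma continuous_map_odometer_coordinate:
  "continuous_map (odometer_space G) (discrete_topology (rcosets\<^bsub>Zd\<^esub> (G j))) (\<lambda>x. x j)"
  unfolding odometer_space_def
  by (intro continuous_map_from_subtopology continuous_map_product_projection) simp

lemma continuous_map_function_of_coordinate:
  "continuous_map (odometer_space G) (discrete_topology UNIV) (\<lambda>x. c (x j))"
  using continuous_map_compose[OF continuous_map_odometer_coordinate, of j "discrete_topology UNIV" c]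
  by (simp add: o_def)

lemma Hausdorff_odometer_space: "Hausdorff_space (odometer_space G)"
  unfolding odometer_space_def
  by (intro Hausdorff_space_subtopology) (simp add: Hausdorff_space_product_topology Hausdorff_space_discrete_topology)

lemma compact_odometer_space: "compact_space (odometer_space G)"
proof -
  define P where "P = product_topology (\<lambda>j. discrete_topology (rcosets\<^bsub>Zd\<^esub> (G j))) UNIV"
  have "compact_space P"
    using odometer_group_finite_index
    by (simp add: P_def compact_space_product_topology compact_space_discrete_topology)
  have coord: "continuous_map P (discrete_topology (rcosets\<^bsub>Zd\<^esub> (G j))) (\<lambda>x. x j)" for j
    unfolding P_def by (rule continuous_map_product_projection) simp
  have pre: "closedin P {x \<in> topspace P. x j = K}" for j K
    using closedin_continuous_map_preimage[OF coord, of j "{K} \<inter> rcosets\<^bsub>Zd\<^esub> (G j)"]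
    by (rule back_subst) (auto simp: P_def PiE_iff)
  have "closedin P {x \<in> topspace P. x (Suc j) \<subseteq> x j}" for j
  proof -
    have "{x \<in> topspace P. x (Suc j) \<subseteq> x j} =
      \<Union> ((\<lambda>(K, L). {x \<in> topspace P. x (Suc j) = K} \<inter> {x \<in> topspace P. x j = L}) `
        {(K, L) \<in> (rcosets\<^bsub>Zd\<^esub> (G (Suc j))) \<times> (rcosets\<^bsub>Zd\<^esub> (G j)). K \<subseteq> L})"
      by (auto simp: P_def PiE_iff)
    moreover have "closedin P \<dots>"
      using pre odometer_group_finite_index
      by (intro closedin_Union finite_imageI) (auto intro: finite_subset[OF _ finite_cartesian_product])
    ultimately show ?thesis by simp
  qed
  then have "closedin P (\<Inter>j. {x \<in> topspace P. x (Suc j) \<subseteq> x j})" by (intro closedin_INT) auto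
  moreover have mem_P: "x \<in> topspace P \<longleftrightarrow> (\<forall>j. x j \<in> rcosets\<^bsub>Zd\<^esub> (G j))" for x
    by (simp add: P_def PiE_iff)
  have "(\<Inter>j. {x \<in> topspace P. x (Suc j) \<subseteq> x j}) = odometer_set G"
    unfolding set_eq_iff INT_iff mem_Collect_eq odometer_set_iff mem_P ball_UNIV by blast
  ultimately have "compactin P (odometer_set G)"
    using closedin_compact_space[OF \<open>compact_space P\<close>] by simp
  then show ?thesis unfolding odometer_space_def P_def[symmetric] by (rule compact_space_subtopology)
qed

text \<open>A basic open set of the product constrains finitely many coordinates, and the last of these
  determines the others.\<close>

lemma open_set_contains_cylinder:
  assumes U: "openin (odometer_space G) U" and x: "x \<in> U"
  obtains j where "{y \<in> odometer_set G. y j = x j} \<subseteq> U"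
proof -
  obtain W where W: "openin (product_topology (\<lambda>j. discrete_topology (rcosets\<^bsub>Zd\<^esub> (G j))) UNIV) W"
    "U = W \<inter> odometer_set G"
    using U by (auto simp: odometer_space_def openin_subtopology)
  then obtain V where V: "x \<in> (\<Pi>\<^sub>E i\<in>UNIV. V i)"
      "finite {i. V i \<noteq> rcosets\<^bsub>Zd\<^esub> (G i)}" "(\<Pi>\<^sub>E i\<in>UNIV. V i) \<subseteq> W"
    using product_topology_open_contains_basis[OF W(1), of x] x by auto
  define j where "j = Max (insert 0 {i. V i \<noteq> rcosets\<^bsub>Zd\<^esub> (G i)})"
  have j: "i \<le> j" if "V i \<noteq> rcosets\<^bsub>Zd\<^esub> (G i)" for i
    using V(2) that by (simp add: j_def)
  have "{y \<in> odometer_set G. y j = x j} \<subseteq> U"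
  proof
    fix y assume "y \<in> {y \<in> odometer_set G. y j = x j}"
    then have y: "y \<in> odometer_set G" "y j = x j" by auto
    have xO: "x \<in> odometer_set G" using x W(2) by blast
    have "y i \<in> V i" for i
    proof (cases "V i = rcosets\<^bsub>Zd\<^esub> (G i)")
      case True
      then show ?thesis using odometer_coset[OF y(1)] by simp
    next
      case False
      then have "y i = x i" using odometer_coordinate_determines_earlier[OF y(1) xO j y(2)] by blast
      then show ?thesis using V(1) by (auto simp: PiE_iff)
    qed
    then have "y \<in> W" using V(3) by (auto simp: PiE_iff)
    then show "y \<in> U" using W(2) y(1) by blast
  qed
  then show thesis using that by blast
qed

text \<open>By compactness finitely many cylinders on which \<open>f\<close> is constant cover the space; the
  largest coordinate occurring in them works.\<close>

lemma locally_constant_factors_through_coordinate: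
  assumes f: "continuous_map (odometer_space G) (discrete_topology UNIV) f"
  obtains j where "\<And>x y. x \<in> odometer_set G \<Longrightarrow> y \<in> odometer_set G \<Longrightarrow> x j = y j \<Longrightarrow> f x = f y"
proof -
  have "\<exists>j. \<forall>y\<in>odometer_set G. y j = x j \<longrightarrow> f y = f x" if x: "x \<in> odometer_set G" for x
  proof -
    have "openin (odometer_space G) {y \<in> odometer_set G. f y = f x}"
      using openin_continuous_map_preimage[OF f, of "{f x}"] by (simp add: topspace_odometer_space)
    then obtain j where "{y \<in> odometer_set G. y j = x j} \<subseteq> {y \<in> odometer_set G. f y = f x}"
      by (rule open_set_contains_cylinder[where x = x]) (use x in auto)
    then show ?thesis by blast
  qed
  then obtain J where J: "\<forall>x\<in>odometer_set G. \<forall>y\<in>odometer_set G. y (J x) = x (J x) \<longrightarrow> f y = f x"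
    using bchoice[of "odometer_set G" "\<lambda>x j. \<forall>y\<in>odometer_set G. y j = x j \<longrightarrow> f y = f x"] by blast
  define U where "U x = {y \<in> odometer_set G. y (J x) = x (J x)}" for x
  have U_open: "openin (odometer_space G) (U x)" for x
  proof -
    have "U x = {y \<in> topspace (odometer_space G). y (J x) \<in> {x (J x)} \<inter> (rcosets\<^bsub>Zd\<^esub> (G (J x)))}"
      unfolding U_def topspace_odometer_space using odometer_coset by force
    then show ?thesis
      using openin_continuous_map_preimage[OF continuous_map_odometer_coordinate,
          of "J x" "{x (J x)} \<inter> (rcosets\<^bsub>Zd\<^esub> (G (J x)))"] by simp
  qed
  have "(\<forall>V\<in>U ` odometer_set G. openin (odometer_space G) V) \<and>
      topspace (odometer_space G) \<subseteq> \<Union> (U ` odometer_set G)"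
    unfolding topspace_odometer_space using U_open by (auto simp: U_def)
  from compact_odometer_space[unfolded compact_space_alt, THEN spec, THEN mp, OF this]
  obtain F where F: "finite F" "F \<subseteq> U ` odometer_set G" "odometer_set G \<subseteq> \<Union>F"
    unfolding topspace_odometer_space by blast
  from finite_subset_image[OF F(1,2)]
  obtain E where E: "E \<subseteq> odometer_set G" "finite E" "F = U ` E" by (elim exE conjE)
  define j where "j = Max (insert 0 (J ` E))"
  have "f x = f y" if x: "x \<in> odometer_set G" and y: "y \<in> odometer_set G" and eq: "x j = y j" for x y
  proof -
    obtain z where z: "z \<in> E" "x \<in> U z" using F(3) E(3) x by blast
    then have "J z \<le> j" using E(2) by (simp add: j_def)
    then have "x (J z) = y (J z)" using odometer_coordinate_determines_earlier[OF x y _ eq] by blast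
    then have eq_z: "x (J z) = z (J z)" "y (J z) = z (J z)" using z(2) by (simp_all add: U_def)
    have "z \<in> odometer_set G" using z(1) E(1) by blast
    note J_z = bspec[OF J this]
    show ?thesis
      using mp[OF bspec[OF J_z x] eq_z(1)] mp[OF bspec[OF J_z y] eq_z(2)] by (rule trans[OF _ sym])
  qed
  then show thesis using that by blast
qed

lemma odometer_map_in_set: "x \<in> odometer_set G \<Longrightarrow> odometer_map v x \<in> odometer_set G"
  unfolding odometer_set_iff odometer_map_def
  by (meson Zd_rcoset_shift_in_rcosets Zd_rcoset_shift[THEN equalityD1] image_mono
      Zd_rcoset_shift[THEN equalityD2] order_trans)

lemma odometer_map_add: "odometer_map (v + w) x = odometer_map v (odometer_map w x)"
  by (auto simp: odometer_map_def Zd_rcoset_shift image_image fun_eq_iff add_ac)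

lemma odometer_map_zero: "odometer_map 0 x = x"
  by (simp add: odometer_map_def Zd_rcoset_shift)

lemma continuous_map_odometer_map:
  "continuous_map (odometer_space G) (odometer_space G) (odometer_map v)"
proof -
  have "continuous_map (odometer_space G) (discrete_topology (rcosets\<^bsub>Zd\<^esub> (G j))) (\<lambda>x. x j #>\<^bsub>Zd\<^esub> v)" for j
    using continuous_map_compose[OF continuous_map_odometer_coordinate,
        of j "discrete_topology (rcosets\<^bsub>Zd\<^esub> (G j))" "\<lambda>K. K #>\<^bsub>Zd\<^esub> v"] Zd_rcoset_shift_in_rcosets
    by (auto simp: o_def Pi_iff)
  then show ?thesis
    by (subst (2) odometer_space_def) (auto simp: continuous_map_in_subtopology continuous_map_componentwise_UNIV odometer_map_def
        topspace_odometer_space Pi_iff intro: odometer_map_in_set[unfolded odometer_map_def])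
qed

lemma zd_action_odometer_map: "zd_action (odometer_space G) odometer_map"
proof -
  have "homeomorphic_maps (odometer_space G) (odometer_space G) (odometer_map v) (odometer_map (- v))" for v
    by (simp add: homeomorphic_maps_def continuous_map_odometer_map odometer_map_zero
        flip: odometer_map_add)
  then show ?thesis
    unfolding zd_action_def homeomorphic_map_maps by (auto simp: odometer_map_add odometer_map_zero)
qed

lemma odometer_map_fixes_coordinate_iff:
  assumes x: "x \<in> odometer_set G"
  shows "odometer_map v x j = x j \<longleftrightarrow> v \<in> G j"
proof -
  obtain u where u: "u \<in> x j" using Zd_rcoset_nonempty[OF odometer_group odometer_coset[OF x]] by blast
  have "u + v \<in> odometer_map v x j" using u by (simp add: odometer_map_def Zd_rcoset_shift)
  moreover have "u + v \<in> x j \<longleftrightarrow> v \<in> G j"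
    using Zd_rcoset_mem_iff[OF odometer_group odometer_coset[OF x] u, of "u + v"] by simp
  ultimately show ?thesis
    using Zd_rcosets_eqI[OF odometer_group odometer_coset[OF odometer_map_in_set[OF x]] odometer_coset[OF x]]
    by blast
qed

end

section \<open>Actions, conjugacies and speedups\<close>

lemma zd_actionD:
  assumes "zd_action X S"
  shows zd_action_continuous: "continuous_map X X (S v)"
    and zd_action_closed: "x \<in> topspace X \<Longrightarrow> S v x \<in> topspace X"
    and zd_action_add: "x \<in> topspace X \<Longrightarrow> S (v + w) x = S v (S w x)"
    and zd_action_zero: "x \<in> topspace X \<Longrightarrow> S 0 x = x"
proof -
  show c: "continuous_map X X (S v)" for v
    using assms homeomorphic_imp_continuous_map by (auto simp: zd_action_def)
  show "x \<in> topspace X \<Longrightarrow> S v x \<in> topspace X"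
    using continuous_map_image_subset_topspace[OF c] by blast
qed (use assms in \<open>auto simp: zd_action_def\<close>)

lemma homeomorphic_mapsD:
  assumes "homeomorphic_maps X Y f g"
  shows "x \<in> topspace X \<Longrightarrow> f x \<in> topspace Y" "y \<in> topspace Y \<Longrightarrow> g y \<in> topspace X"
    "x \<in> topspace X \<Longrightarrow> g (f x) = x" "y \<in> topspace Y \<Longrightarrow> f (g y) = y"
proof -
  have "f ` topspace X \<subseteq> topspace Y" "g ` topspace Y \<subseteq> topspace X"
    using assms continuous_map_image_subset_topspace unfolding homeomorphic_maps_def by blast+
  then show "x \<in> topspace X \<Longrightarrow> f x \<in> topspace Y" "y \<in> topspace Y \<Longrightarrow> g y \<in> topspace X" by auto
qed (use assms in \<open>simp_all add: homeomorphic_maps_def\<close>)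

lemma zd_action_transport:
  assumes hom: "homeomorphic_maps X Y \<Phi> \<Psi>" and S: "zd_action X S"
  shows "zd_action Y (\<lambda>v y. \<Phi> (S v (\<Psi> y)))"
proof -
  note \<Psi> = homeomorphic_mapsD[OF hom]
  have "homeomorphic_map Y Y (\<lambda>y. \<Phi> (S v (\<Psi> y)))" for v
  proof -
    have "homeomorphic_map Y X \<Psi>" "homeomorphic_map X Y \<Phi>"
      using hom by (auto simp: homeomorphic_maps_map)
    moreover have "homeomorphic_map X X (S v)" using S by (simp add: zd_action_def)
    ultimately have "homeomorphic_map Y Y (\<Phi> \<circ> (S v \<circ> \<Psi>))"
      by (intro homeomorphic_map_compose)
    then show ?thesis by (simp add: o_def)
  qed
  then show ?thesis
    unfolding zd_action_def
    by (auto simp: \<Psi> zd_action_add[OF S] zd_action_zero[OF S] zd_action_closed[OF S])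
qed

lemma conjugate_transport:
  assumes hom: "homeomorphic_maps X Y \<Phi> \<Psi>" and S: "zd_action X S"
  shows "conjugate X S Y (\<lambda>v y. \<Phi> (S v (\<Psi> y)))"
  unfolding conjugate_def using hom by (intro exI[of _ \<Phi>]) (auto simp: homeomorphic_maps_map)

lemma conjugate_sym:
  assumes S: "zd_action X S" and conj: "conjugate X S Y R"
  shows "conjugate Y R X S"
proof -
  obtain \<Phi> where \<Phi>: "homeomorphic_map X Y \<Phi>" "\<And>v x. x \<in> topspace X \<Longrightarrow> \<Phi> (S v x) = R v (\<Phi> x)"
    using conj by (auto simp: conjugate_def)
  obtain \<Psi> where hom: "homeomorphic_maps X Y \<Phi> \<Psi>" using \<Phi>(1) by (auto simp: homeomorphic_map_maps)
  have "homeomorphic_map Y X \<Psi>" using hom by (simp add: homeomorphic_maps_map)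
  note \<Psi> = this homeomorphic_mapsD(2,4,3)[OF hom]
  have "\<Psi> (R v y) = S v (\<Psi> y)" if "y \<in> topspace Y" for v y
  proof -
    have "R v y = \<Phi> (S v (\<Psi> y))" using \<Phi>(2)[OF \<Psi>(2)[OF that], of v] \<Psi>(3)[OF that] by simp
    then show ?thesis using \<Psi>(4)[OF zd_action_closed[OF S \<Psi>(2)[OF that]]] by simp
  qed
  then show ?thesis using \<Psi>(1) by (auto simp: conjugate_def)
qed

lemma conjugate_trans:
  assumes "conjugate X S Y R" "conjugate Y R Z Q"
  shows "conjugate X S Z Q"
proof -
  obtain \<Phi> \<Theta> where \<Phi>: "homeomorphic_map X Y \<Phi>" "\<And>v x. x \<in> topspace X \<Longrightarrow> \<Phi> (S v x) = R v (\<Phi> x)"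
    and \<Theta>: "homeomorphic_map Y Z \<Theta>" "\<And>v x. x \<in> topspace Y \<Longrightarrow> \<Theta> (R v x) = Q v (\<Theta> x)"
    using assms by (auto simp: conjugate_def)
  moreover have "\<Phi> x \<in> topspace Y" if "x \<in> topspace X" for x
    using homeomorphic_imp_surjective_map[OF \<Phi>(1)] that by blast
  ultimately show ?thesis
    unfolding conjugate_def by (intro exI[of _ "\<Theta> \<circ> \<Phi>"]) (auto intro: homeomorphic_map_compose)
qed

lemma free_action_inj:
  assumes free: "free_action X T" and x: "x \<in> topspace X" and eq: "T a x = T b x"
  shows "a = b"
proof -
  have T: "zd_action X T" using free unfolding free_action_def by blast
  have "T (a - b) x = T (- b) (T a x)" using zd_action_add[OF T x, of "- b" a] by simp
  also have "\<dots> = T (- b) (T b x)" by (simp only: eq)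
  also have "\<dots> = T 0 x" by (simp flip: zd_action_add[OF T x])
  also have "\<dots> = x" using zd_action_zero[OF T x] .
  finally have "a - b = 0" using free x unfolding free_action_def by blast
  then show ?thesis by simp
qed

text \<open>Freeness turns the composition law of \<open>R\<close> into the cocycle identity, so an action inside the
  orbits of a free action is a speedup of it without further conditions on the time change.\<close>

lemma free_action_cocycle:
  assumes free: "free_action X T" and R: "zd_action X R"
    and p: "\<And>x v. x \<in> topspace X \<Longrightarrow> R v x = T (p (x, v)) x"
  shows "cocycle X T p"
proof -
  have T: "zd_action X T" using free unfolding free_action_def by blast
  have "p (x, v) + p (T (p (x, v)) x, w) = p (x, v + w)" if x: "x \<in> topspace X" for x v w
  proof (rule free_action_inj[OF free x])
    have Rx: "R v x \<in> topspace X" using zd_action_closed[OF R x] .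
    have "T (p (x, v) + p (T (p (x, v)) x, w)) x = T (p (R v x, w)) (T (p (x, v)) x)"
      using zd_action_add[OF T x, of "p (R v x, w)" "p (x, v)"] by (simp add: p[OF x] add.commute)
    also have "\<dots> = R w (R v x)" using p[OF x, of v] p[OF Rx, of w] by simp
    also have "\<dots> = T (p (x, v + w)) x"
      using zd_action_add[OF R x, of w v] p[OF x, of "v + w"] by (simp add: add.commute)
    finally show "T (p (x, v) + p (T (p (x, v)) x, w)) x = T (p (x, v + w)) x" .
  qed
  moreover have "p (x, 0) = 0" if x: "x \<in> topspace X" for x
  proof -
    have "T (p (x, 0)) x = x" using trans[OF sym[OF p[OF x]] zd_action_zero[OF R x]] .
    then show ?thesis using free x unfolding free_action_def by blast
  qed
  ultimately show ?thesis by (simp add: cocycle_def)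
qed

section \<open>Cocycles over odometers\<close>

text \<open>A label is a locally constant choice of a representative of the coset modulo \<open>G\<close> to which
  a point of an odometer projects. Working with representatives instead of cosets turns the action into
  addition up to elements of \<open>G\<close>.\<close>

definition coset_label :: "'a topology \<Rightarrow> (int^'d \<Rightarrow> 'a \<Rightarrow> 'a) \<Rightarrow> (int^'d) set \<Rightarrow> ('a \<Rightarrow> int^'d) \<Rightarrow> bool" where
  "coset_label X S G \<tau> \<longleftrightarrow> continuous_map X (discrete_topology UNIV) \<tau> \<and>
     (\<forall>x\<in>topspace X. \<forall>v. \<tau> (S v x) - (\<tau> x + v) \<in> G)"

lemma continuous_map_discrete_UNIV_iff:
  "continuous_map X (discrete_topology UNIV) f \<longleftrightarrow> (\<forall>c. openin X {x \<in> topspace X. f x = c})"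
proof
  assume "continuous_map X (discrete_topology UNIV) f"
  from openin_continuous_map_preimage[OF this, of "{c}" for c]
  show "\<forall>c. openin X {x \<in> topspace X. f x = c}" by simp
next
  assume op: "\<forall>c. openin X {x \<in> topspace X. f x = c}"
  have "openin X {x \<in> topspace X. f x \<in> U}" for U
  proof -
    have "{x \<in> topspace X. f x \<in> U} = (\<Union>c\<in>U. {x \<in> topspace X. f x = c})" by auto
    moreover have "openin X \<dots>" using op by (intro openin_Union) auto
    ultimately show ?thesis by simp
  qed
  then show "continuous_map X (discrete_topology UNIV) f" by (simp add: continuous_map_def)
qed

text \<open>The label picks an element of the coset at a coordinate through which \<open>f\<close> factors.\<close>

lemma odometer_coset_label:
  assumes Gs: "odometer_groups Gs" and conj: "conjugate X S (odometer_space Gs) odometer_map"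
    and f: "continuous_map X (discrete_topology UNIV) f"
  obtains j \<tau> where "coset_label X S (Gs j) \<tau>"
    "\<And>x y. x \<in> topspace X \<Longrightarrow> y \<in> topspace X \<Longrightarrow> \<tau> x - \<tau> y \<in> Gs j \<Longrightarrow> f x = f y"
proof -
  obtain \<Phi> where \<Phi>: "homeomorphic_map X (odometer_space Gs) \<Phi>"
    "\<And>v x. x \<in> topspace X \<Longrightarrow> \<Phi> (S v x) = odometer_map v (\<Phi> x)"
    using conj by (auto simp: conjugate_def)
  obtain \<Psi> where hom: "homeomorphic_maps X (odometer_space Gs) \<Phi> \<Psi>"
    using \<Phi>(1) by (auto simp: homeomorphic_map_maps)
  have \<Phi>_in: "\<Phi> x \<in> odometer_set Gs" and \<Psi>: "\<Psi> (\<Phi> x) = x" if "x \<in> topspace X" for x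
    using hom that continuous_map_image_subset_topspace[of X "odometer_space Gs" \<Phi>]
    by (auto simp: homeomorphic_maps_def topspace_odometer_space[OF Gs])
  have "continuous_map (odometer_space Gs) (discrete_topology UNIV) (f \<circ> \<Psi>)"
    using hom f by (auto simp: homeomorphic_maps_def intro: continuous_map_compose)
  then obtain j where j: "\<And>x y. x \<in> odometer_set Gs \<Longrightarrow> y \<in> odometer_set Gs \<Longrightarrow> x j = y j \<Longrightarrow>
      (f \<circ> \<Psi>) x = (f \<circ> \<Psi>) y"
    using locally_constant_factors_through_coordinate[OF Gs] by blast
  note grp = odometer_group[OF Gs, of j]
  define \<tau> where "\<tau> x = (SOME u. u \<in> \<Phi> x j)" for x
  have \<tau>: "\<tau> x \<in> \<Phi> x j" if "x \<in> topspace X" for x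
    using Zd_rcoset_nonempty[OF grp odometer_coset[OF Gs \<Phi>_in[OF that]]]
    unfolding \<tau>_def by (simp add: some_in_eq)
  have "coset_label X S (Gs j) \<tau>"
    unfolding coset_label_def
  proof (intro conjI ballI allI)
    have "continuous_map X (discrete_topology UNIV) ((\<lambda>x. SOME u. u \<in> x j) \<circ> \<Phi>)"
      using hom continuous_map_function_of_coordinate[OF Gs, of "\<lambda>K. SOME u. u \<in> K" j]
      by (auto simp: homeomorphic_maps_def intro: continuous_map_compose)
    then show "continuous_map X (discrete_topology UNIV) \<tau>" by (simp add: \<tau>_def[abs_def] o_def)
    fix x v assume x: "x \<in> topspace X"
    have eq: "\<Phi> (S v x) j = (\<lambda>u. u + v) ` \<Phi> x j"
      by (simp add: \<Phi>(2)[OF x] odometer_map_def Zd_rcoset_shift)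
    have "\<Phi> (S v x) = odometer_map v (\<Phi> x)" using \<Phi>(2)[OF x] .
    then have "\<Phi> (S v x) j \<in> rcosets\<^bsub>Zd\<^esub> (Gs j)"
      using odometer_coset[OF Gs odometer_map_in_set[OF Gs \<Phi>_in[OF x]]] by simp
    moreover have "\<tau> x + v \<in> \<Phi> (S v x) j" using \<tau>[OF x] eq by simp
    moreover have "\<tau> (S v x) \<in> \<Phi> (S v x) j"
      unfolding \<tau>_def using \<open>\<tau> x + v \<in> \<Phi> (S v x) j\<close> by (rule someI)
    ultimately show "\<tau> (S v x) - (\<tau> x + v) \<in> Gs j" using Zd_rcoset_mem_iff[OF grp] by blast
  qed
  moreover have "f x = f y" if x: "x \<in> topspace X" and y: "y \<in> topspace X" and d: "\<tau> x - \<tau> y \<in> Gs j" for x y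
  proof -
    have "\<tau> x \<in> \<Phi> y j"
      using Zd_rcoset_mem_iff[OF grp odometer_coset[OF Gs \<Phi>_in[OF y]] \<tau>[OF y]] d by blast
    then have "\<Phi> x j = \<Phi> y j"
      using Zd_rcosets_eqI[OF grp odometer_coset[OF Gs \<Phi>_in[OF x]] odometer_coset[OF Gs \<Phi>_in[OF y]] \<tau>[OF x]]
      by blast
    then show ?thesis using j[OF \<Phi>_in[OF x] \<Phi>_in[OF y]] \<Psi> x y by simp
  qed
  ultimately show thesis using that by blast
qed

text \<open>The values \<open>p (x, e\<^sub>i)\<close> depend only on the label of \<open>x\<close> modulo some
  \<open>Gs j\<close>, and the cocycle identity propagates this to \<open>p (x, v)\<close> for every
  \<open>v\<close>. Consequently \<open>p\<close> is the increment of one function \<open>q\<close> on the lattice. For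
  \<open>g \<in> Gs j\<close> the points \<open>x\<close> and \<open>S g x\<close> have the same label up to
  \<open>Gs j\<close>, so comparing \<open>p (x, u + g)\<close> with \<open>p (x, g + u)\<close> shows that
  \<open>p (x, g)\<close> is constant along orbits. This is the rigidity behind both parts.\<close>

lemma cocycle_over_odometer:
  fixes S :: "int^'d \<Rightarrow> 'a \<Rightarrow> 'a" and p :: "'a \<times> (int^'d) \<Rightarrow> int^'m"
  assumes Gs: "odometer_groups Gs" and conj: "conjugate X S (odometer_space Gs) odometer_map"
    and S: "zd_action X S" and nonempty: "topspace X \<noteq> {}"
    and p: "\<And>x v w. x \<in> topspace X \<Longrightarrow> p (x, v + w) = p (x, v) + p (S v x, w)"
    and cont: "\<And>v. continuous_map X (discrete_topology UNIV) (\<lambda>x. p (x, v))"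
  obtains j \<tau> q A where "coset_label X S (Gs j) \<tau>"
    "\<And>x v. x \<in> topspace X \<Longrightarrow> p (x, v) = q (\<tau> x + v) - q (\<tau> x)"
    "\<And>v g. g \<in> Gs j \<Longrightarrow> q (v + g) = q v + A g"
proof -
  \<comment> \<open>One function that collects the values on all basis vectors yields one common \<open>j\<close>.\<close>
  define f :: "'a \<Rightarrow> (int^'m)^'d" where "f x = (\<chi> i. p (x, axis i 1))" for x
  have "continuous_map X (discrete_topology UNIV) f"
    unfolding continuous_map_discrete_UNIV_iff
  proof
    fix c
    have "{x \<in> topspace X. f x = c} = (\<Inter>i. {x \<in> topspace X. p (x, axis i 1) = c $ i})"
      by (auto simp: f_def vec_eq_iff)
    moreover have "openin X \<dots>"
      using cont by (intro openin_INT2) (auto simp: continuous_map_discrete_UNIV_iff)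
    ultimately show "openin X {x \<in> topspace X. f x = c}" by simp
  qed
  then obtain j \<tau> where \<tau>: "coset_label X S (Gs j) \<tau>"
    and f: "\<And>x y. x \<in> topspace X \<Longrightarrow> y \<in> topspace X \<Longrightarrow> \<tau> x - \<tau> y \<in> Gs j \<Longrightarrow> f x = f y"
    using odometer_coset_label[OF Gs conj] by blast
  note grp = odometer_group[OF Gs, of j]
  have label: "\<tau> (S v x) - (\<tau> x + v) \<in> Gs j" if "x \<in> topspace X" for x v
    using \<tau> that by (simp add: coset_label_def)
  have label2: "\<tau> (S v x) - \<tau> (S v y) \<in> Gs j"
    if "x \<in> topspace X" "y \<in> topspace X" "\<tau> x - \<tau> y \<in> Gs j" for x y v
    using Zd_subgroup_diff[OF grp Zd_subgroup_add[OF grp label[OF that(1), of v] that(3)] label[OF that(2), of v]]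
    by (simp add: algebra_simps)
  have p_zero: "p (x, 0) = 0" if "x \<in> topspace X" for x
    using p[OF that, of 0 0] zd_action_zero[OF S that] by simp
  have same: "\<forall>x\<in>topspace X. \<forall>y\<in>topspace X. \<tau> x - \<tau> y \<in> Gs j \<longrightarrow> p (x, v) = p (y, v)" for v
  proof (induction v rule: int_vec_induct)
    case 1
    show ?case by (simp add: p_zero)
  next
    case (2 i)
    then show ?case using f by (auto simp: f_def vec_eq_iff)
  next
    case (3 u v)
    then show ?case using label2 zd_action_closed[OF S] by (simp add: p)
  next
    case (4 u)
    have "p (x, - u) = - p (S (- u) x, u)" if "x \<in> topspace X" for x
    proof -
      have "p (x, - u) + p (S (- u) x, u) = 0" using p[OF that, of "- u" u] p_zero[OF that] by simp
      then show ?thesis by (simp only: eq_neg_iff_add_eq_0)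
    qed
    then show ?case using 4 label2 zd_action_closed[OF S] by simp
  qed
  obtain x0 where x0: "x0 \<in> topspace X" using nonempty by blast
  define q where "q v = p (x0, v - \<tau> x0)" for v
  have pq: "p (x, v) = q (\<tau> x + v) - q (\<tau> x)" if x: "x \<in> topspace X" for x v
  proof -
    define u where "u = \<tau> x - \<tau> x0"
    have "\<tau> (S u x0) - \<tau> x \<in> Gs j" using label[OF x0, of u] by (simp add: u_def)
    then have "p (x, v) = p (S u x0, v)" using same zd_action_closed[OF S x0] x by simp
    moreover have "p (x0, u + v) = p (x0, u) + p (S u x0, v)" using p[OF x0] .
    ultimately show ?thesis by (simp add: q_def u_def algebra_simps)
  qed
  have "q (v + g) - q v = q (v' + g) - q v'" if g: "g \<in> Gs j" for v v' g
  proof -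
    have per: "p (S u x0, g) = p (x0, g)" for u
    proof -
      have "\<tau> (S g x0) - \<tau> x0 \<in> Gs j"
        using Zd_subgroup_add[OF grp label[OF x0, of g] g] by simp
      then have "p (S g x0, u) = p (x0, u)" using same zd_action_closed[OF S x0] x0 by simp
      moreover have "p (x0, u) + p (S u x0, g) = p (x0, g) + p (S g x0, u)"
        using p[OF x0, of u g] p[OF x0, of g u] by (simp add: add.commute)
      ultimately show ?thesis by simp
    qed
    have "q (v + g) - q v = p (x0, g)" for v
      using p[OF x0, of "v - \<tau> x0" g] per[of "v - \<tau> x0"] by (simp add: q_def algebra_simps)
    then show ?thesis by simp
  qed
  then have "q (v + g) = q v + (q g - q 0)" if "g \<in> Gs j" for v g
    using that by (metis add_0 add.commute diff_add_cancel)
  then show thesis using that[OF \<tau> pq, of "\<lambda>g. q g - q 0"] by blast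
qed

section \<open>Rearranging an action inside its orbits\<close>

lemma continuous_map_locally_constant_time:
  assumes S: "zd_action X S" and \<tau>: "continuous_map X (discrete_topology UNIV) \<tau>"
  shows "continuous_map X X (\<lambda>x. S (c (\<tau> x)) x)"
  unfolding continuous_map_def
proof (intro conjI allI impI)
  show "(\<lambda>x. S (c (\<tau> x)) x) \<in> topspace X \<rightarrow> topspace X" using zd_action_closed[OF S] by auto
  fix U assume U: "openin X U"
  have "{x \<in> topspace X. S (c (\<tau> x)) x \<in> U} =
      (\<Union>u. {x \<in> topspace X. \<tau> x = u} \<inter> {x \<in> topspace X. S (c u) x \<in> U})" by auto
  moreover have "openin X \<dots>"
    using \<tau> openin_continuous_map_preimage[OF zd_action_continuous[OF S] U]
    by (intro openin_Union) (auto simp: continuous_map_discrete_UNIV_iff)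
  ultimately show "openin X {x \<in> topspace X. S (c (\<tau> x)) x \<in> U}" by simp
qed

lemma equivariant_perm_inverse:
  assumes "equivariant_perm G \<pi>"
  shows "equivariant_perm G (inv_into UNIV \<pi>)"
proof -
  have bij: "bij \<pi>" and eq: "\<And>v g. g \<in> G \<Longrightarrow> \<pi> (v + g) = \<pi> v + g"
    using assms by (auto simp: equivariant_perm_def)
  have "inv_into UNIV \<pi> (v + g) = inv_into UNIV \<pi> v + g" if "g \<in> G" for v g
    using eq[OF that, of "inv_into UNIV \<pi> v"] bij
    by (metis bij_inv_eq_iff)
  then show ?thesis using bij by (simp add: equivariant_perm_def bij_imp_bij_inv)
qed

text \<open>The rearrangement moves the coset labelled by \<open>u\<close> to the coset of \<open>\<pi> u\<close>, and its
  displacement \<open>\<pi> u - u\<close> is unaffected by changing the representative.\<close>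

lemma rearrangement_label:
  assumes grp: "subgroup G Zd" and \<tau>: "coset_label X S G \<tau>"
    and \<pi>: "equivariant_perm G \<pi>" and x: "x \<in> topspace X"
  shows "\<tau> (S (\<pi> (\<tau> x) - \<tau> x) x) - \<pi> (\<tau> x) \<in> G"
    and "\<pi> (\<tau> (S v x)) - \<tau> (S v x) = \<pi> (\<tau> x + v) - (\<tau> x + v)"
proof -
  have label: "\<tau> (S v x) - (\<tau> x + v) \<in> G" for v using \<tau> x by (simp add: coset_label_def)
  show "\<tau> (S (\<pi> (\<tau> x) - \<tau> x) x) - \<pi> (\<tau> x) \<in> G" using label[of "\<pi> (\<tau> x) - \<tau> x"] by simp
  have "\<pi> (\<tau> x + v + (\<tau> (S v x) - (\<tau> x + v))) = \<pi> (\<tau> x + v) + (\<tau> (S v x) - (\<tau> x + v))"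
    using \<pi> label[of v] unfolding equivariant_perm_def by blast
  then show "\<pi> (\<tau> (S v x)) - \<tau> (S v x) = \<pi> (\<tau> x + v) - (\<tau> x + v)" by (simp add: algebra_simps)
qed

text \<open>The rearrangement by the inverse permutation undoes the displacement, by
  \<open>rearrangement_label\<close>.\<close>

lemma homeomorphic_rearrangement:
  assumes S: "zd_action X S" and grp: "subgroup G Zd" and \<tau>: "coset_label X S G \<tau>"
    and \<pi>: "equivariant_perm G \<pi>"
  shows "homeomorphic_maps X X (\<lambda>x. S (\<pi> (\<tau> x) - \<tau> x) x)
           (\<lambda>x. S (inv_into UNIV \<pi> (\<tau> x) - \<tau> x) x)"
proof -
  have \<tau>_cont: "continuous_map X (discrete_topology UNIV) \<tau>" using \<tau> by (simp add: coset_label_def)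
  have cancel: "S (\<rho> (\<tau> (S (\<pi> (\<tau> x) - \<tau> x) x)) - \<tau> (S (\<pi> (\<tau> x) - \<tau> x) x)) (S (\<pi> (\<tau> x) - \<tau> x) x) = x"
    if \<rho>: "equivariant_perm G \<rho>" and inv: "\<And>v. \<rho> (\<pi> v) = v" and x: "x \<in> topspace X" for \<rho> \<pi> x
  proof -
    have "\<rho> (\<tau> (S (\<pi> (\<tau> x) - \<tau> x) x)) - \<tau> (S (\<pi> (\<tau> x) - \<tau> x) x) = \<tau> x - \<pi> (\<tau> x)"
      using rearrangement_label(2)[OF grp \<tau> \<rho> x, of "\<pi> (\<tau> x) - \<tau> x"] inv by simp
    then show ?thesis using zd_action_zero[OF S x] by (simp flip: zd_action_add[OF S x])
  qed
  have bij: "bij \<pi>" using \<pi> by (simp add: equivariant_perm_def)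
  show ?thesis
    unfolding homeomorphic_maps_def
  proof (intro conjI ballI)
    show "continuous_map X X (\<lambda>x. S (\<pi> (\<tau> x) - \<tau> x) x)"
      by (rule continuous_map_locally_constant_time[OF S \<tau>_cont, of "\<lambda>u. \<pi> u - u"])
    show "continuous_map X X (\<lambda>x. S (inv_into UNIV \<pi> (\<tau> x) - \<tau> x) x)"
      by (rule continuous_map_locally_constant_time[OF S \<tau>_cont, of "\<lambda>u. inv_into UNIV \<pi> u - u"])
  next
    fix x assume "x \<in> topspace X"
    then show "S (inv_into UNIV \<pi> (\<tau> (S (\<pi> (\<tau> x) - \<tau> x) x)) - \<tau> (S (\<pi> (\<tau> x) - \<tau> x) x))
        (S (\<pi> (\<tau> x) - \<tau> x) x) = x"
      using cancel[OF equivariant_perm_inverse[OF \<pi>]] bij by (simp add: bij_is_inj)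
  next
    fix x assume "x \<in> topspace X"
    then show "S (\<pi> (\<tau> (S (inv_into UNIV \<pi> (\<tau> x) - \<tau> x) x)) - \<tau> (S (inv_into UNIV \<pi> (\<tau> x) - \<tau> x) x))
        (S (inv_into UNIV \<pi> (\<tau> x) - \<tau> x) x) = x"
      using cancel[OF \<pi>, of "inv_into UNIV \<pi>"] bij by (simp add: bij_is_surj surj_f_inv_f)
  qed
qed

text \<open>Conjugating \<open>S\<close> with the rearrangement \<open>\<Theta>\<close> given by \<open>\<pi>\<close>
  replaces the function \<open>q\<close>, whose increments are the orbit cocycle, by \<open>q \<circ> \<pi>\<close>;
  and \<open>\<pi>\<close> can be chosen so that the steps of \<open>q \<circ> \<pi>\<close> lie in a cone.\<close>

lemma cone_speedup_of_same_orbits: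
  fixes T S :: "int^'d \<Rightarrow> 'a \<Rightarrow> 'a"
  assumes T: "free_action X T" and S: "free_action X S"
    and Gs: "odometer_groups Gs" and conj: "conjugate X S (odometer_space Gs) odometer_map"
    and h: "\<And>x v. x \<in> topspace X \<Longrightarrow> S v x = T (h (x, v)) x"
    and cont: "\<And>v. continuous_map X (discrete_topology UNIV) (\<lambda>x. h (x, v))"
    and orbit: "\<And>x w. x \<in> topspace X \<Longrightarrow> \<exists>v. h (x, v) = w"
    and nonempty: "topspace X \<noteq> {}"
  obtains C R where "lattice_cone C" "cone_speedup X T C R" "conjugate X S X R"
proof -
  have actS: "zd_action X S" and actT: "zd_action X T" using S T unfolding free_action_def by blast+
  have "cocycle X T h" using free_action_cocycle[OF T actS h] .
  then have "h (x, v + w) = h (x, v) + h (S v x, w)" if "x \<in> topspace X" for x v w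
    using h[OF that] that by (simp add: cocycle_def)
  then obtain j \<tau> q A where \<tau>: "coset_label X S (Gs j) \<tau>"
    and hq: "\<And>x v. x \<in> topspace X \<Longrightarrow> h (x, v) = q (\<tau> x + v) - q (\<tau> x)"
    and q: "\<And>v g. g \<in> Gs j \<Longrightarrow> q (v + g) = q v + A g"
    using cocycle_over_odometer[OF Gs conj actS nonempty _ cont] by blast
  note grp = odometer_group[OF Gs, of j]
  obtain D where D: "D > 0" "\<And>v. D *s v \<in> Gs j"
    using finite_index_multiples[OF grp odometer_group_finite_index[OF Gs]] by blast
  obtain x0 where x0: "x0 \<in> topspace X" using nonempty by blast
  have "bij q"
  proof (rule bijI)
    show "inj q"
    proof (rule injI)
      fix v w assume "q v = q w"
      then have "h (x0, v - \<tau> x0) = h (x0, w - \<tau> x0)" by (simp add: hq[OF x0])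
      then have "S (v - \<tau> x0) x0 = S (w - \<tau> x0) x0" by (simp add: h[OF x0])
      then show "v = w" using free_action_inj[OF S x0] by fastforce
    qed
    have "\<exists>v. q v = w" for w
      using orbit[OF x0, of "w - q (\<tau> x0)"] by (auto simp: hq[OF x0])
    then show "surj q" by (metis surjI)
  qed
  then obtain \<pi> C where \<pi>: "equivariant_perm (Gs j) \<pi>" and C: "lattice_cone C"
    and step: "\<And>u i. q (\<pi> (u + axis i 1)) - q (\<pi> u) \<in> C"
    using cone_steps_rearrangement[OF grp D q] by blast
  define \<Theta> where "\<Theta> x = S (\<pi> (\<tau> x) - \<tau> x) x" for x
  define \<Theta>' where "\<Theta>' x = S (inv_into UNIV \<pi> (\<tau> x) - \<tau> x) x" for x
  have hom: "homeomorphic_maps X X \<Theta> \<Theta>'"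
    unfolding \<Theta>_def \<Theta>'_def by (rule homeomorphic_rearrangement[OF actS grp \<tau> \<pi>])
  define R where "R v x = \<Theta> (S v (\<Theta>' x))" for v x
  have R: "zd_action X R" "conjugate X S X R"
    unfolding R_def using zd_action_transport[OF hom actS] conjugate_transport[OF hom actS] by auto
  define p where "p = (\<lambda>(x, v). q (\<pi> (\<tau> (\<Theta>' x) + v)) - q (\<pi> (\<tau> (\<Theta>' x))))"
  have p: "R v x = T (p (x, v)) x" if x: "x \<in> topspace X" for x v
  proof -
    define y where "y = \<Theta>' x"
    have y: "y \<in> topspace X" "\<Theta> y = x"
      unfolding y_def by (rule homeomorphic_mapsD[OF hom] x)+
    have "R v x = S (\<pi> (\<tau> (S v y)) - \<tau> (S v y)) (S v y)" by (simp add: R_def \<Theta>_def y_def)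
    also have "\<dots> = S (\<pi> (\<tau> y + v) - (\<tau> y + v)) (S v y)"
      using rearrangement_label(2)[OF grp \<tau> \<pi> y(1)] by simp
    also have "\<dots> = S (\<pi> (\<tau> y + v) - \<tau> y) y"
      by (simp flip: zd_action_add[OF actS y(1)])
    also have "\<dots> = S (\<pi> (\<tau> y + v) - \<pi> (\<tau> y)) (\<Theta> y)"
      unfolding \<Theta>_def by (simp flip: zd_action_add[OF actS y(1)])
    also have "\<dots> = T (h (x, \<pi> (\<tau> y + v) - \<pi> (\<tau> y))) x" by (simp add: y(2) h[OF x])
    also have "h (x, \<pi> (\<tau> y + v) - \<pi> (\<tau> y)) = p (x, v)"
    proof -
      have "\<tau> x - \<pi> (\<tau> y) \<in> Gs j"
        using rearrangement_label(1)[OF grp \<tau> \<pi> y(1)] y(2) by (simp add: \<Theta>_def)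
      then have "q (u + (\<tau> x - \<pi> (\<tau> y))) = q u + A (\<tau> x - \<pi> (\<tau> y))" for u using q by blast
      from this[of "\<pi> (\<tau> y + v)"] this[of "\<pi> (\<tau> y)"] show ?thesis
        by (simp add: hq[OF x] p_def y_def[symmetric] algebra_simps)
    qed
    finally show ?thesis .
  qed
  have "speedup_via X T p R"
    using free_action_cocycle[OF T R(1) p] R(1) p by (simp add: speedup_via_def)
  moreover have "cone_valued X C p" using step by (simp add: cone_valued_def p_def)
  ultimately have "cone_speedup X T C R" by (auto simp: cone_speedup_def)
  then show thesis using that C R(2) by blast
qed

text \<open>The orbit equivalence carries \<open>S\<close> to an action \<open>S'\<close> on \<open>X\<close> that has the same
  orbits as \<open>T\<close>.\<close>

lemma cone_speedup_of_continuously_orbit_equivalent_odometer: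
  fixes X :: "'a topology" and T :: "int^'d \<Rightarrow> 'a \<Rightarrow> 'a" and Y :: "'b topology" and S :: "int^'d \<Rightarrow> 'b \<Rightarrow> 'b"
  assumes odo: "odometer Y S" and coe: "continuously_orbit_equivalent X T Y S"
  obtains C R where "lattice_cone C" "cone_speedup X T C R" "conjugate Y S X R"
proof -
  obtain \<Phi> \<Psi> h where free: "free_action X T" "free_action Y S"
    and oe: "orbit_equivalent_via X T Y S \<Phi>" and hom: "homeomorphic_maps X Y \<Phi> \<Psi>"
    and h: "orbit_cocycle X T S \<Phi> h" and h_cont: "continuous_cocycle X h"
    using coe unfolding continuously_orbit_equivalent_def by blast
  obtain Gs where Gs: "odometer_groups Gs" and conj: "conjugate Y S (odometer_space Gs) odometer_map"
    using odo by (auto simp: odometer_def)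
  have actT: "zd_action X T" and actS: "zd_action Y S" using free unfolding free_action_def by blast+
  note \<Phi>\<Psi> = homeomorphic_mapsD[OF hom]
  have hom': "homeomorphic_maps Y X \<Psi> \<Phi>" using hom homeomorphic_maps_sym by blast
  define S' where "S' v x = \<Psi> (S v (\<Phi> x))" for v x
  have S': "zd_action X S'" "conjugate Y S X S'"
    unfolding S'_def by (rule zd_action_transport[OF hom' actS] conjugate_transport[OF hom' actS])+
  have "v = 0" if x: "x \<in> topspace X" and fix_x: "S' v x = x" for v x
  proof -
    have "\<Phi> (S' v x) = S v (\<Phi> x)"
      using \<Phi>\<Psi>(4)[OF zd_action_closed[OF actS \<Phi>\<Psi>(1)[OF x]]] by (simp add: S'_def)
    then have "S v (\<Phi> x) = \<Phi> x" by (simp only: fix_x)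
    then show ?thesis using free(2) \<Phi>\<Psi>(1)[OF x] unfolding free_action_def by blast
  qed
  then have free': "free_action X S'" using S'(1) unfolding free_action_def by blast
  have conj': "conjugate X S' (odometer_space Gs) odometer_map"
    using conjugate_trans[OF conjugate_sym[OF actS S'(2)] conj] .
  have h': "S' v x = T (h (x, v)) x" if x: "x \<in> topspace X" for x v
    using h x \<Phi>\<Psi>(3)[OF zd_action_closed[OF actT x]] by (simp add: S'_def orbit_cocycle_def)
  have h'_cont: "continuous_map X (discrete_topology UNIV) (\<lambda>x. h (x, v))" for v
  proof -
    have "continuous_map X (prod_topology X (discrete_topology UNIV)) (\<lambda>x. (x, v))"
      by (simp add: continuous_map_pairwise o_def)
    then have "continuous_map X (discrete_topology UNIV) (h \<circ> (\<lambda>x. (x, v)))"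
      using h_cont unfolding continuous_cocycle_def by (rule continuous_map_compose)
    then show ?thesis by (simp add: o_def)
  qed
  have orbit: "\<exists>v. h (x, v) = w" if x: "x \<in> topspace X" for x w
  proof -
    have "\<Phi> (T w x) \<in> range (\<lambda>v. S v (\<Phi> x))"
      using oe x unfolding orbit_equivalent_via_def by blast
    then obtain v where "\<Phi> (T w x) = S v (\<Phi> x)" by blast
    then have "T w x = S' v x" using \<Phi>\<Psi>(3)[OF zd_action_closed[OF actT x], of w] by (simp add: S'_def)
    then have "T (h (x, v)) x = T w x" using h'[OF x, of v] by simp
    then have "h (x, v) = w" by (rule free_action_inj[OF free(1) x])
    then show ?thesis by blast
  qed
  have nonempty: "topspace X \<noteq> {}"
  proof -
    obtain \<Xi> where "homeomorphic_map Y (odometer_space Gs) \<Xi>" using conj by (auto simp: conjugate_def)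
    then have "\<Xi> ` topspace Y = odometer_set Gs"
      using homeomorphic_imp_surjective_map topspace_odometer_space[OF Gs] by metis
    then have "topspace Y \<noteq> {}" using odometer_set_nonempty[OF Gs] by auto
    then show ?thesis using \<Phi>\<Psi>(2) by blast
  qed
  obtain C R where C: "lattice_cone C" "cone_speedup X T C R" "conjugate X S' X R"
    by (rule cone_speedup_of_same_orbits[OF free(1) free' Gs conj' h' h'_cont orbit nonempty])
  show thesis using that[OF C(1,2) conjugate_trans[OF S'(2) C(3)]] .
qed

section \<open>An odometer with no bounded speedup in a prescribed cone\<close>

text \<open>The two coordinates use coprime primes. A homomorphism compatible with this sequence of groups
  can therefore not mix the coordinate axes.\<close>

definition two_three_groups :: "nat \<Rightarrow> (int^2) set" where
  "two_three_groups k = {v. 2 ^ k dvd v $ 1 \<and> 3 ^ k dvd v $ 2}"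

lemma odometer_groups_two_three: "odometer_groups two_three_groups"
proof -
  have grp: "subgroup (two_three_groups k) Zd" for k
  proof (rule subgroup.intro)
    show "two_three_groups k \<subseteq> carrier Zd" by simp
  qed (auto simp: two_three_groups_def)
  moreover have "finite (rcosets\<^bsub>Zd\<^esub> (two_three_groups k))" for k
  proof (rule finite_rcosets_if_multiples[OF grp])
    show "(6 ^ k :: int) > 0" by simp
    have "(6::int) ^ k = 2 ^ k * 3 ^ k" by (simp flip: power_mult_distrib)
    then show "6 ^ k *s v \<in> two_three_groups k" for v by (simp add: two_three_groups_def)
  qed
  moreover have "decseq two_three_groups"
    by (auto simp: decseq_def two_three_groups_def intro: dvd_trans[OF le_imp_power_dvd])
  ultimately show ?thesis by (simp add: odometer_groups_def)
qed

lemma eq_zero_if_all_powers_dvd: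
  fixes b c :: int
  assumes "b > 1" and dvd: "\<And>k. b ^ k dvd c"
  shows "c = 0"
proof (rule ccontr)
  assume "c \<noteq> 0"
  then have "b ^ nat \<bar>c\<bar> \<le> \<bar>c\<bar>" using dvd[of "nat \<bar>c\<bar>"] by (simp add: zdvd_imp_le)
  moreover have "int n < b ^ n" for n
  proof (induction n)
    case (Suc n)
    have "2 * b ^ n \<le> b * b ^ n" using \<open>b > 1\<close> by (intro mult_right_mono) auto
    moreover have "b ^ n \<ge> 1" using \<open>b > 1\<close> by simp
    ultimately show ?case using Suc.IH unfolding power_Suc of_nat_Suc by linarith
  qed simp
  then have "\<bar>c\<bar> < b ^ nat \<bar>c\<bar>" by (metis abs_ge_zero int_nat_eq)
  ultimately show False by simp
qed

lemma free_action_two_three: "free_action (odometer_space two_three_groups) odometer_map"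
  unfolding free_action_def
proof (intro conjI allI ballI impI)
  show "zd_action (odometer_space two_three_groups) odometer_map"
    by (rule zd_action_odometer_map[OF odometer_groups_two_three])
  fix v :: "int^2" and x assume "x \<in> topspace (odometer_space two_three_groups)" "odometer_map v x = x"
  then have "v \<in> two_three_groups k" for k
    using odometer_map_fixes_coordinate_iff[OF odometer_groups_two_three, of x v k]
    by (simp add: topspace_odometer_space[OF odometer_groups_two_three])
  then have "v $ 1 = 0" "v $ 2 = 0"
    by (auto simp: two_three_groups_def intro: eq_zero_if_all_powers_dvd[of 2] eq_zero_if_all_powers_dvd[of 3])
  then show "v = 0" by (simp add: vec_eq_iff forall_2)
qed

lemma continuously_orbit_equivalent_refl:
  assumes "free_action X T"
  shows "continuously_orbit_equivalent X T X T"
  unfolding continuously_orbit_equivalent_def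
proof (intro conjI exI)
  show "free_action X T" "free_action X T" by fact+
  show "orbit_equivalent_via X T X T (\<lambda>x. x)"
    by (simp add: orbit_equivalent_via_def homeomorphic_map_id[unfolded id_def])
  show "homeomorphic_maps X X (\<lambda>x. x) (\<lambda>x. x)" by (simp add: homeomorphic_maps_def)
  show "orbit_cocycle X T T (\<lambda>x. x) snd" "orbit_cocycle X T T (\<lambda>x. x) snd"
    by (simp_all add: orbit_cocycle_def)
  show "continuous_cocycle X snd" "continuous_cocycle X snd"
    by (simp_all add: continuous_cocycle_def continuous_map_snd)
qed

lemma lattice_cone_positive_quadrant: "lattice_cone {v :: int^2. v $ 1 > 0 \<and> v $ 2 > 0}"
proof -
  define F :: "(real^2) set" where "F = {x. \<forall>i. 0 \<bullet> x + 1 * x $ i > 0}"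
  have "filled_cone F" "\<forall>x\<in>F. \<forall>y\<in>F. x + y \<in> F"
    using filled_cone_skewed_orthant[of 1 "0 :: real^2"] unfolding F_def by auto
  moreover have "{v :: int^2. v $ 1 > 0 \<and> v $ 2 > 0} = {v. real_vec v \<in> F} - {0}"
    by (auto simp: F_def forall_2)
  ultimately show ?thesis unfolding lattice_cone_def by blast
qed

text \<open>A bounded cocycle takes finitely many values at \<open>v\<close>. By freeness the set where it takes the
  value \<open>w\<close> is the set where the continuous maps \<open>R v\<close> and \<open>T w\<close> agree, which
  is closed; a finite partition into closed sets consists of open sets.\<close>

lemma bounded_cocycle_continuous:
  assumes free: "free_action X T" and Haus: "Hausdorff_space X"
    and R: "speedup_via X T p R" and bdd: "bounded_cocycle X p"
  shows "continuous_map X (discrete_topology UNIV) (\<lambda>x. p (x, v))"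
  unfolding continuous_map_discrete_UNIV_iff
proof
  fix c
  have actT: "zd_action X T" using free unfolding free_action_def by blast
  have actR: "zd_action X R" and p: "\<And>x. x \<in> topspace X \<Longrightarrow> R v x = T (p (x, v)) x"
    using R by (auto simp: speedup_via_def)
  define V where "V = (\<lambda>x. p (x, v)) ` topspace X"
  have "bounded (real_vec ` V)" using bdd by (simp add: bounded_cocycle_def V_def image_image)
  then obtain b where b: "\<And>w. w \<in> V \<Longrightarrow> norm (real_vec w) \<le> b" unfolding bounded_iff by blast
  have "V \<subseteq> {w. \<forall>i. w $ i \<in> {- \<lceil>b\<rceil>..\<lceil>b\<rceil>}}"
  proof
    fix w assume "w \<in> V"
    have "\<bar>real_of_int (w $ i)\<bar> \<le> b" for i
      using component_le_norm_cart[of "real_vec w" i] b[OF \<open>w \<in> V\<close>] by simp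
    then have "\<bar>w $ i\<bar> \<le> \<lceil>b\<rceil>" for i by (metis le_of_int_ceiling of_int_abs of_int_le_iff order_trans)
    then show "w \<in> {w. \<forall>i. w $ i \<in> {- \<lceil>b\<rceil>..\<lceil>b\<rceil>}}" by (auto simp: abs_le_iff) (smt (verit))
  qed
  then have "finite V" by (rule finite_subset) (rule finite_int_box)
  define E where "E w = {x \<in> topspace X. R v x = T w x}" for w
  have E: "closedin X (E w)" for w
    unfolding E_def
    using closedin_continuous_maps_eq[OF Haus zd_action_continuous[OF actR] zd_action_continuous[OF actT]] .
  have E_eq: "E w = {x \<in> topspace X. p (x, v) = w}" for w
    unfolding E_def using p free_action_inj[OF free] by fastforce
  have "{x \<in> topspace X. p (x, v) = c} = topspace X - \<Union> (E ` (V - {c}))"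
    by (auto simp: E_eq V_def)
  moreover have "closedin X (\<Union> (E ` (V - {c})))"
    using \<open>finite V\<close> E by (intro closedin_Union) auto
  ultimately show "openin X {x \<in> topspace X. p (x, v) = c}"
    by (simp only: openin_diff[OF openin_topspace])
qed

lemma cone_valued_multiple:
  assumes C: "lattice_cone C" and p: "cocycle X T p" and closed: "\<And>x v. x \<in> topspace X \<Longrightarrow> T (p (x, v)) x \<in> topspace X"
    and val: "cone_valued X C p" and x: "x \<in> topspace X"
  shows "p (x, int (Suc n) *s axis i 1) \<in> C"
  using x
proof (induction n arbitrary: x)
  case 0
  then show ?case using val by (simp add: cone_valued_def)
next
  case (Suc n)
  have "int (Suc (Suc n)) *s axis i 1 = axis i 1 + int (Suc n) *s axis i (1::int)"
    by (simp add: vec_eq_iff distrib_right axis_def)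
  then have "p (x, int (Suc (Suc n)) *s axis i 1)
      = p (x, axis i 1) + p (T (p (x, axis i 1)) x, int (Suc n) *s axis i 1)"
    using p Suc.prems by (simp add: cocycle_def)
  moreover have "p (x, axis i 1) \<in> C" using val Suc.prems by (simp add: cone_valued_def)
  ultimately show ?case
    using lattice_cone_add[OF C] Suc.IH[OF closed[OF Suc.prems]] by simp
qed

text \<open>By continuity of \<open>p\<close>, the time \<open>p (x, g)\<close> is a homomorphism \<open>A\<close> of
  \<open>g\<close> in some group of the sequence. The points \<open>R (2\<^sup>m g) x\<close> with
  \<open>g = 2\<^sup>j e\<^sub>1\<close> converge to \<open>x\<close>, so \<open>2\<^sup>m A g\<close> eventually lies in
  every group of the sequence. Its second coordinate is then divisible by every power of \<open>3\<close>, so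
  \<open>A g\<close> lies on the first axis, outside the open quadrant.\<close>

lemma two_three_no_bounded_quadrant_speedup:
  fixes R :: "int^2 \<Rightarrow> (nat \<Rightarrow> (int^2) set) \<Rightarrow> (nat \<Rightarrow> (int^2) set)"
  assumes R: "bounded_cone_speedup (odometer_space two_three_groups) odometer_map {v. v $ 1 > 0 \<and> v $ 2 > 0} R"
    and conj: "conjugate (odometer_space two_three_groups) R (odometer_space two_three_groups) odometer_map"
  shows False
proof -
  let ?X = "odometer_space two_three_groups"
  note H = odometer_groups_two_three
  note top = topspace_odometer_space[OF H]
  obtain p where p: "speedup_via ?X odometer_map p R" and bdd: "bounded_cocycle ?X p"
    and val: "cone_valued ?X {v. v $ 1 > 0 \<and> v $ 2 > 0} p"
    using R by (auto simp: bounded_cone_speedup_def)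
  have actR: "zd_action ?X R" and coc: "cocycle ?X odometer_map p"
    and Rp: "\<And>x v. x \<in> topspace ?X \<Longrightarrow> R v x = odometer_map (p (x, v)) x"
    using p by (auto simp: speedup_via_def)
  have p_add: "p (x, v + w) = p (x, v) + p (R v x, w)" if "x \<in> topspace ?X" for x v w
    using coc that by (simp add: cocycle_def Rp)
  have p_cont: "continuous_map ?X (discrete_topology UNIV) (\<lambda>x. p (x, v))" for v
    using bounded_cocycle_continuous[OF free_action_two_three Hausdorff_odometer_space[OF H] p bdd] .
  obtain j \<tau> q A where \<tau>: "coset_label ?X R (two_three_groups j) \<tau>"
    and pq: "\<And>x v. x \<in> topspace ?X \<Longrightarrow> p (x, v) = q (\<tau> x + v) - q (\<tau> x)"
    and q: "\<And>v g. g \<in> two_three_groups j \<Longrightarrow> q (v + g) = q v + A g"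
    using cocycle_over_odometer[OF H conj actR _ p_add p_cont] odometer_set_nonempty[OF H] top by metis
  obtain x where x: "x \<in> topspace ?X" using odometer_set_nonempty[OF H] top by blast
  have pA: "p (x, g) = A g" if "g \<in> two_three_groups j" for g
    using pq[OF x, of g] q[OF that, of "\<tau> x"] by simp
  define g :: "int^2" where "g = 2 ^ j *s axis 1 1"
  have mult_g: "2 ^ m *s g \<in> two_three_groups (m + j)" for m
    by (simp add: two_three_groups_def g_def power_add axis_def)
  have g: "g \<in> two_three_groups j" using mult_g[of 0] by simp
  obtain D where D: "D > 0" "\<And>v. D *s v \<in> two_three_groups j"
    using finite_index_multiples[OF odometer_group[OF H] odometer_group_finite_index[OF H]] by blast
  have A_mult: "A (2 ^ m *s g) = 2 ^ m *s A g" for m :: nat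
    using translation_part_scale[OF odometer_group[OF H] D q g] .
  have "3 ^ k dvd A g $ 2" for k :: nat
  proof -
    have "continuous_map ?X (discrete_topology UNIV) (\<lambda>x. x k)"
      using continuous_map_function_of_coordinate[OF H, of "\<lambda>K. K" k] .
    then obtain m \<tau>' where \<tau>': "coset_label ?X R (two_three_groups m) \<tau>'"
      and coord: "\<And>x y. x \<in> topspace ?X \<Longrightarrow> y \<in> topspace ?X \<Longrightarrow> \<tau>' x - \<tau>' y \<in> two_three_groups m \<Longrightarrow> x k = y k"
      using odometer_coset_label[OF H conj] by metis
    define w where "w = 2 ^ m *s g"
    have w: "w \<in> two_three_groups m" "w \<in> two_three_groups j"
      using mult_g[of m] odometer_group_mono[OF H, of m "m + j"] odometer_group_mono[OF H, of j "m + j"]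
      by (auto simp: w_def)
    have "\<tau>' (R w x) - (\<tau>' x + w) \<in> two_three_groups m" using \<tau>' x by (simp add: coset_label_def)
    then have "\<tau>' (R w x) - \<tau>' x \<in> two_three_groups m"
      using Zd_subgroup_add[OF odometer_group[OF H] _ w(1)] by fastforce
    then have "R w x k = x k" using coord[OF zd_action_closed[OF actR x] x] by blast
    then have "p (x, w) \<in> two_three_groups k"
      using odometer_map_fixes_coordinate_iff[OF H, of x "p (x, w)" k] x top by (simp add: Rp)
    moreover have "p (x, w) = 2 ^ m *s A g" using pA[OF w(2)] by (simp add: w_def A_mult)
    ultimately have "3 ^ k dvd 2 ^ m * A g $ 2" by (simp add: two_three_groups_def)
    moreover have "coprime ((3::int) ^ k) (2 ^ m)" by simp
    ultimately show ?thesis by (simp add: coprime_dvd_mult_right_iff)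
  qed
  then have "A g $ 2 = 0" by (intro eq_zero_if_all_powers_dvd[of 3]) auto
  moreover have "p (x, int (Suc (2 ^ j - 1)) *s axis 1 1) \<in> {v. v $ 1 > 0 \<and> v $ 2 > 0}"
    using cone_valued_multiple[OF lattice_cone_positive_quadrant coc _ val x]
      zd_action_closed[OF zd_action_odometer_map[OF H]] by blast
  then have "p (x, g) \<in> {v. v $ 1 > 0 \<and> v $ 2 > 0}" by (simp add: g_def)
  then have "A g $ 2 > 0" using pA[OF g] by simp
  ultimately show False by simp
qed

theorem theoremE:
  "(\<forall>(X :: 'a topology) (T :: int^'d \<Rightarrow> 'a \<Rightarrow> 'a) (Y :: 'b topology) (S :: int^'d \<Rightarrow> 'b \<Rightarrow> 'b).
      odometer X T \<and> odometer Y S \<and> continuously_orbit_equivalent X T Y S \<longrightarrow>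
      (\<exists>C. lattice_cone C \<and>
         ((\<exists>R. cone_speedup Y S C R \<and> conjugate X T Y R) \<or>
          (\<exists>R. cone_speedup X T C R \<and> conjugate Y S X R)))) \<and>
   (\<exists>(X :: (nat \<Rightarrow> (int^2) set) topology) (T :: int^2 \<Rightarrow> _ \<Rightarrow> _)
     (Y :: (nat \<Rightarrow> (int^2) set) topology) (S :: int^2 \<Rightarrow> _ \<Rightarrow> _) (C :: (int^2) set).
      odometer X T \<and> odometer Y S \<and> continuously_orbit_equivalent X T Y S \<and> lattice_cone C \<and>
      \<not> (\<exists>R :: int^2 \<Rightarrow> _ \<Rightarrow> _. bounded_cone_speedup X T C R \<and> conjugate X R Y S))"
proof (rule conjI)
  show "\<forall>(X :: 'a topology) (T :: int^'d \<Rightarrow> 'a \<Rightarrow> 'a) (Y :: 'b topology) (S :: int^'d \<Rightarrow> 'b \<Rightarrow> 'b).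
      odometer X T \<and> odometer Y S \<and> continuously_orbit_equivalent X T Y S \<longrightarrow>
      (\<exists>C. lattice_cone C \<and>
         ((\<exists>R. cone_speedup Y S C R \<and> conjugate X T Y R) \<or>
          (\<exists>R. cone_speedup X T C R \<and> conjugate Y S X R)))"
    using cone_speedup_of_continuously_orbit_equivalent_odometer by metis
next
  let ?X = "odometer_space two_three_groups"
  have "zd_action ?X odometer_map" by (rule zd_action_odometer_map[OF odometer_groups_two_three])
  moreover have "conjugate ?X odometer_map ?X odometer_map"
    unfolding conjugate_def by (intro exI[of _ id]) (simp add: homeomorphic_map_id)
  ultimately have "odometer ?X odometer_map" using odometer_groups_two_three by (auto simp: odometer_def)
  then show "\<exists>(X :: (nat \<Rightarrow> (int^2) set) topology) (T :: int^2 \<Rightarrow> _ \<Rightarrow> _)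
     (Y :: (nat \<Rightarrow> (int^2) set) topology) (S :: int^2 \<Rightarrow> _ \<Rightarrow> _) (C :: (int^2) set).
      odometer X T \<and> odometer Y S \<and> continuously_orbit_equivalent X T Y S \<and> lattice_cone C \<and>
      \<not> (\<exists>R :: int^2 \<Rightarrow> _ \<Rightarrow> _. bounded_cone_speedup X T C R \<and> conjugate X R Y S)"
    using continuously_orbit_equivalent_refl[OF free_action_two_three] lattice_cone_positive_quadrant
      two_three_no_bounded_quadrant_speedup by blast
qed

end
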